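(* Let $X,Y_1,Y_2$ be real separable Banach spaces and let $\mu$ be a Gaussian measure on $\mathcal{B}(X)$ with mean element $m_\mu$ and covariance operator $C_\mu:X^*\to X$. Let $G_1:X\to Y_1$ and $G_2:X\to Y_2$ be bounded linear operators, and let $\nu:=\mu\circ(G_1,G_2)^{-1}$ on $Y:=Y_1\bigoplus Y_2$. Then there exists a subspace $Y_0=Y_0^{(1)}\bigoplus Y_0^{(2)}\subset Y$, with $Y_0^{(1)}\subset Y_1$ and $Y_0^{(2)}\subset Y_2$, such that $\nu(Y_0)=1$ and, for suitable versions of the Gaussian disintegrations involved, for all $(y_1,y_2)\in Y_0^{(1)}\bigoplus Y_0^{(2)}$, $$\mu_{|(G_1,G_2)=(y_1,y_2)}=\left(\mu_{|G_1=y_1}\right)_{|G_2=y_2}.$$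
   Context: The operator $(G_1,G_2):X\to Y_1\bigoplus Y_2$ is $x\mapsto G_1(x)\bigoplus G_2(x)$; $Y_1\bigoplus Y_2$ carries any norm inducing the product topology. Banach spaces carry their Borel $\sigma$-algebras. No finite-rank assumption is made on $G_1C_\mu G_1^*$ or $G_2C_\mu G_2^*$. A Gaussian measure on a separable Banach space is a Borel probability measure all of whose pushforwards by continuous linear functionals are Gaussian (possibly degenerate). With $\langle f,g^*\rangle=g^*(f)$, its mean element is the unique $m_\mu\in X$ with $\int_X\langle f,g^*\rangle d\mu(f)=\langle m_\mu,g^*\rangle$ for all $g^*\in X^*$; its covariance operator $C_\mu:X^*\to X$ satisfies $\langle C_\mu g_1^*,g_2^*\rangle=\int_X(\langle f,g_1^*\rangle-\langle m_\mu,g_1^*\rangle)(\langle f,g_2^*\rangle-\langle m_\mu,g_2^*\rangle)\,d\mu(f)$. Given a probability measure $\mu$ on $(X,\mathcal{A})$ and a measurable map $G:X\to(Y,\mathcal{C})$, a disintegration of $\mu$ with respect to $G$ is a map $\tilde\mu:\mathcal{A}\times Y\to[0,1]$, written $\mu_{|G=y}(\cdot):=\tilde\mu(\cdot,y)$, such that: (1) each $\tilde\mu(\cdot,y)$ is a probability measure and each $\tilde\mu(A,\cdot)$ is measurable; (2) there is a set in $\mathcal{C}$ of full $\mu\circ G^{-1}$-measure such that for all $y$ in it $\{y\}\in\mathcal{C}$ and $\tilde\mu(G^{-1}(\{y\}),y)=1$; (3) $\mu(A)=\int_Y\tilde\mu(A,y)\,d(\mu\circ G^{-1})(y)$ for all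 $A\in\mathcal{A}$. It may be given only for $y$ in a set of full $\mu\circ G^{-1}$-measure, and is unique only up to $\mu\circ G^{-1}$-null sets. For a Gaussian measure and a bounded linear operator there is a disintegration consisting of Gaussian measures; $\mu_{|G=y}$ denotes such a Gaussian disintegrating measure, and $(\mu_{|G_1=y_1})_{|G_2=y_2}$ denotes the one obtained by disintegrating the Gaussian measure $\mu_{|G_1=y_1}$ with respect to $G_2$. *)

theory Defs
  imports "HOL-Probability.Probability"
begin

definition gaussian_real :: "real measure \<Rightarrow> bool" where
  "gaussian_real M \<longleftrightarrow>
     (\<exists>a. M = return borel a) \<or>
     (\<exists>a \<sigma>. \<sigma> > 0 \<and> M = density lborel (\<lambda>x. ennreal (normal_density a \<sigma> x)))"

definition gaussian_measure :: "'a::{banach, second_countable_topology} measure \<Rightarrow> bool" where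
  "gaussian_measure M \<longleftrightarrow>
     prob_space M \<and> sets M = sets borel \<and>
     (\<forall>g :: 'a \<Rightarrow>\<^sub>L real. gaussian_real (distr M borel (blinfun_apply g)))"

definition is_mean_element :: "'a::{banach, second_countable_topology} measure \<Rightarrow> 'a \<Rightarrow> bool" where
  "is_mean_element M m \<longleftrightarrow>
     (\<forall>g :: 'a \<Rightarrow>\<^sub>L real. has_bochner_integral M (blinfun_apply g) (blinfun_apply g m))"

definition is_covariance_operator ::
    "'a::{banach, second_countable_topology} measure \<Rightarrow> 'a \<Rightarrow> (('a \<Rightarrow>\<^sub>L real) \<Rightarrow> 'a) \<Rightarrow> bool" where
  "is_covariance_operator M m C \<longleftrightarrow>
     (\<forall>g h :: 'a \<Rightarrow>\<^sub>L real. has_bochner_integral M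
        (\<lambda>f. (blinfun_apply g f - blinfun_apply g m) * (blinfun_apply h f - blinfun_apply h m))
        (blinfun_apply h (C g)))"

(* The measure N serves only as the target measurable space of G.  The kernel is total on
   space N; one given only on a set of full measure is extended by a constant kernel. *)
definition disintegration ::
    "'a measure \<Rightarrow> 'b measure \<Rightarrow> ('a \<Rightarrow> 'b) \<Rightarrow> ('b \<Rightarrow> 'a measure) \<Rightarrow> bool" where
  "disintegration M N G D \<longleftrightarrow>
     prob_space M \<and> G \<in> measurable M N \<and>
     (\<forall>y\<in>space N. prob_space (D y) \<and> sets (D y) = sets M) \<and>
     (\<forall>A\<in>sets M. (\<lambda>y. emeasure (D y) A) \<in> borel_measurable N) \<and>
     (\<exists>S\<in>sets N. emeasure (distr M N G) S = 1 \<and>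
        (\<forall>y\<in>S. {y} \<in> sets N \<and> emeasure (D y) (G -` {y} \<inter> space M) = 1)) \<and>
     (\<forall>A\<in>sets M. emeasure M A = (\<integral>\<^sup>+ y. emeasure (D y) A \<partial>(distr M N G)))"

definition gaussian_disintegration ::
    "'a::{banach, second_countable_topology} measure \<Rightarrow>
     ('a \<Rightarrow> 'b::{banach, second_countable_topology}) \<Rightarrow> ('b \<Rightarrow> 'a measure) \<Rightarrow> bool" where
  "gaussian_disintegration M G D \<longleftrightarrow>
     disintegration M borel G D \<and> (\<forall>y. gaussian_measure (D y))"

end

theory Submission
  imports Defs
begin

text \<open>
  A Gaussian vector x can be written as T (G x) + z, where T (G x) is the measurable linear
  regression of x on G x and the residual z is a centred Gaussian vector that is independent
  of G x and satisfies G z = 0 almost surely. The translates T y + z, with y as parameter,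
  therefore form a Gaussian disintegration with respect to G (gaussian_regression,
  disintegration_translates). Apply this to \<mu> and G1, which gives T1 and a residual law
  \<kappa>1, and then to \<kappa>1 and G2, which gives T2 and a residual law \<kappa>2.
  Every conditional measure of \<mu> given G1 is a translate of \<kappa>1, so one map T2
  serves all of them at once, and the conditional measure given G1 = y1 and then G2 = y2 is
  the translate of \<kappa>2 by T1 y1 + T2 (y2 - G2 (T1 y1)). This depends measurably on the
  pair (y1, y2). Any iterated disintegration that is jointly measurable is a disintegration
  with respect to the pair (iterated_disintegration). With these versions the identity holds
  for all y1 and y2, so that the full spaces can be taken as the two subspaces.

  The main work is the construction of T, in which no finite-rank assumption is available.
  Choose countably many functionals g j that separate the points of the range space.
  Gram--Schmidt with respect to the covariance form gives finite-rank predictions P n of x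
  from g 0 (G x), ..., g (n - 1) (G x), and on functionals P n acts as an orthogonal
  projection. Functionals of P n x converge in mean square. Convergence in norm is a
  compactness matter: because 2 P - 1 preserves the centred measure for every such
  projection P, the increments of P n x lie in a common compact set with high probability,
  and on a compact set convergence of countably many functionals is convergence in norm.
  Hence P n x is Cauchy in probability and converges almost surely along a subsequence; T is
  the limit (regression_Cauchy_in_probability, AE_convergent_subsequence).

  Invariance under reflections and the independence of prediction and residual are
  equalities of Borel measures on a Banach space. Both are read off from characteristic
  functionals, which determine a Borel measure on a separable Banach space
  (borel_measure_eqI_char_functional). That theorem and the choice of the g j rest on the
  Hahn--Banach theorem.
\<close>

section \<open>Norming functionals\<close>

text \<open>
  Positive homogeneity is only required as an inequality, which halves the work when new
  sublinear functionals are constructed; equality follows by rescaling back.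
\<close>

definition sublinear :: "('a::real_vector \<Rightarrow> real) \<Rightarrow> bool" where
  "sublinear p \<longleftrightarrow> (\<forall>x y. p (x + y) \<le> p x + p y) \<and> (\<forall>c x. c > 0 \<longrightarrow> p (c *\<^sub>R x) \<le> c * p x) \<and> p 0 = 0"

lemma sublinearD:
  assumes "sublinear p"
  shows "p (x + y) \<le> p x + p y" "c \<ge> 0 \<Longrightarrow> p (c *\<^sub>R x) = c * p x" "p 0 = 0" "- p (- x) \<le> p x"
proof -
  show 1: "p (x + y) \<le> p x + p y" and 2: "p 0 = 0" using assms by (auto simp: sublinear_def)
  have "p (x + - x) \<le> p x + p (- x)" using assms unfolding sublinear_def by blast
  then show "- p (- x) \<le> p x" using 2 by simp
  show "p (c *\<^sub>R x) = c * p x" if "c \<ge> 0"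
  proof (cases "c = 0")
    case False
    with that have c: "c > 0" by simp
    have "p (c *\<^sub>R x) \<le> c * p x" using assms c by (auto simp: sublinear_def)
    moreover have "p ((1 / c) *\<^sub>R (c *\<^sub>R x)) \<le> (1 / c) * p (c *\<^sub>R x)"
      using assms c unfolding sublinear_def by (metis zero_less_divide_1_iff)
    ultimately show ?thesis using c by (simp add: field_simps)
  qed (use 2 in simp)
qed

text \<open>
  Replacing p(x) by the infimum of p(x + ty) - t p(y) over t \<ge> 0 keeps sublinearity and
  can only lower p. A functional that cannot be lowered in this way in any direction must be
  additive, and if p is a norm, the value at -y is lowered to - p(y).
\<close>

lemma sublinear_lower_in_direction:
  fixes p :: "'a::real_vector \<Rightarrow> real"
  assumes p: "sublinear p"
  obtains q where "sublinear q" "\<And>x. q x \<le> p x" "\<And>x. q x \<le> p (x + y) - p y"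
proof -
  \<comment> \<open>bounded below by - p (- x), so that the infimum is a real number\<close>
  define q where "q x = (INF t\<in>{0..}. p (x + t *\<^sub>R y) - t * p y)" for x
  have low: "- p (- x) \<le> p (x + t *\<^sub>R y) - t * p y" if "t \<ge> 0" for t x
  proof -
    have "p (- x + (x + t *\<^sub>R y)) \<le> p (- x) + p (x + t *\<^sub>R y)" by (rule sublinearD(1)[OF p])
    then show ?thesis using sublinearD(2)[OF p that, of y] by simp
  qed
  have q_le: "q x \<le> p (x + t *\<^sub>R y) - t * p y" if "t \<ge> 0" for t x
    unfolding q_def using that low by (intro cINF_lower bdd_belowI2[where m="- p (- x)"]) auto
  have le_q: "r \<le> q x" if "\<And>t. t \<ge> 0 \<Longrightarrow> r \<le> p (x + t *\<^sub>R y) - t * p y" for r x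
    unfolding q_def using that by (intro cINF_greatest) auto
  have "sublinear q"
    unfolding sublinear_def
  proof (intro conjI allI impI)
    fix x z
    have "q (x + z) - (p (z + s *\<^sub>R y) - s * p y) \<le> q x" if s: "s \<ge> 0" for s
    proof (rule le_q)
      fix t :: real assume t: "t \<ge> 0"
      have "q (x + z) \<le> p ((x + z) + (t + s) *\<^sub>R y) - (t + s) * p y" using s t by (intro q_le) auto
      also have "(x + z) + (t + s) *\<^sub>R y = (x + t *\<^sub>R y) + (z + s *\<^sub>R y)" by (simp add: algebra_simps)
      also have "p \<dots> \<le> p (x + t *\<^sub>R y) + p (z + s *\<^sub>R y)" by (rule sublinearD(1)[OF p])
      finally show "q (x + z) - (p (z + s *\<^sub>R y) - s * p y) \<le> p (x + t *\<^sub>R y) - t * p y"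
        by (simp add: algebra_simps)
    qed
    then have "q (x + z) - q x \<le> q z" by (intro le_q) force
    then show "q (x + z) \<le> q x + q z" by simp
  next
    fix c :: real and x assume c: "c > 0"
    have "(1 / c) * q (c *\<^sub>R x) \<le> q x"
    proof (rule le_q)
      fix t :: real assume t: "t \<ge> 0"
      have "q (c *\<^sub>R x) \<le> p (c *\<^sub>R x + (c * t) *\<^sub>R y) - (c * t) * p y" using c t by (intro q_le) auto
      also have "c *\<^sub>R x + (c * t) *\<^sub>R y = c *\<^sub>R (x + t *\<^sub>R y)" by (simp add: algebra_simps)
      also have "p \<dots> = c * p (x + t *\<^sub>R y)" using c by (intro sublinearD(2)[OF p]) auto
      finally show "(1 / c) * q (c *\<^sub>R x) \<le> p (x + t *\<^sub>R y) - t * p y"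
        using c by (simp add: field_simps)
    qed
    then show "q (c *\<^sub>R x) \<le> c * q x" using c by (simp add: field_simps)
  next
    have "q 0 \<le> 0" using q_le[of 0 0] sublinearD(3)[OF p] by simp
    moreover have "0 \<le> q 0" by (rule le_q) (simp add: sublinearD(2)[OF p])
    ultimately show "q 0 = 0" by simp
  qed
  moreover have "q x \<le> p x" for x using q_le[of 0 x] by simp
  moreover have "q x \<le> p (x + y) - p y" for x using q_le[of 1 x] by simp
  ultimately show ?thesis using that by blast
qed

lemma minimal_sublinear_imp_linear:
  fixes p :: "'a::real_vector \<Rightarrow> real"
  assumes p: "sublinear p" and min: "\<And>q. sublinear q \<Longrightarrow> (\<And>x. q x \<le> p x) \<Longrightarrow> q = p"
  shows "linear p"
proof -
  have add: "p (x + y) = p x + p y" for x y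
  proof -
    obtain q where q: "sublinear q" "\<And>x. q x \<le> p x" "\<And>x. q x \<le> p (x + y) - p y"
      using sublinear_lower_in_direction[OF p, of y] by blast
    then have "q = p" using min by blast
    then have "p x \<le> p (x + y) - p y" using q(3)[of x] by simp
    with sublinearD(1)[OF p, of x y] show ?thesis by simp
  qed
  have neg: "p (- x) = - p x" for x
    using add[of x "- x"] sublinearD(3)[OF p] by simp
  show "linear p"
  proof
    fix r :: real and x
    show "p (r *\<^sub>R x) = r *\<^sub>R p x"
      using sublinearD(2)[OF p, of r x] sublinearD(2)[OF p, of "- r" x] neg[of "r *\<^sub>R x"]
      by (cases "r \<ge> 0") auto
  qed (rule add)
qed

text \<open>
  Hahn--Banach in its algebraic form. Zorn's lemma is applied to total sublinear functionals
  ordered pointwise, so that no partial extensions from subspaces have to be handled: the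
  infimum of a chain is again sublinear, and a minimal element is linear.
\<close>

lemma sublinear_dominates_linear:
  fixes p :: "'a::real_vector \<Rightarrow> real"
  assumes p: "sublinear p"
  obtains f where "linear f" "\<And>x. f x \<le> p x"
proof -
  define A where "A = {q. sublinear q \<and> (\<forall>x. q x \<le> p x)}"
  define P where "P q r \<longleftrightarrow> (\<forall>x. r x \<le> (q x :: real))" for q r :: "'a \<Rightarrow> real"
  have "\<exists>m\<in>A. \<forall>a\<in>A. P m a \<longrightarrow> a = m"
  proof (rule predicate_Zorn)
    show "partial_order_on A (relation_of P A)"
      unfolding partial_order_on_def preorder_on_def refl_on_def trans_def antisym_def relation_of_def P_def
      by (fastforce intro: order_trans simp: fun_eq_iff order_antisym)
  next
    fix C assume C: "C \<in> Chains (relation_of P A)"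
    have CA: "C \<subseteq> A" using Chains_relation_of[OF C] .
    show "\<exists>u\<in>A. \<forall>a\<in>C. P a u"
    proof (cases "C = {}")
      case True
      then show ?thesis using p by (auto simp: A_def)
    next
      case ne: False
      define u where "u x = (INF q\<in>C. q x)" for x
      have low: "- p (- x) \<le> q x" if "q \<in> C" for q x
      proof -
        have q: "sublinear q" "q (- x) \<le> p (- x)" using that CA by (auto simp: A_def)
        show ?thesis using sublinearD(4)[OF q(1), of x] q(2) by simp
      qed
      have u_le: "u x \<le> q x" if "q \<in> C" for q x
        unfolding u_def using that low by (intro cINF_lower bdd_belowI2[where m="- p (- x)"]) auto
      have le_u: "r \<le> u x" if "\<And>q. q \<in> C \<Longrightarrow> r \<le> q x" for r x
        unfolding u_def using that ne by (intro cINF_greatest) auto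
      have "sublinear u"
        unfolding sublinear_def
      proof (intro conjI allI impI)
        fix x y
        have *: "u (x + y) \<le> q1 x + q2 y" if q: "q1 \<in> C" "q2 \<in> C" for q1 q2
        proof -
          have "P q1 q2 \<or> P q2 q1" using C q by (auto simp: Chains_def relation_of_def)
          then obtain q where "q \<in> C" "\<And>x. q x \<le> q1 x" "\<And>x. q x \<le> q2 x"
            using q unfolding P_def by (metis order_refl)
          moreover from this have "q (x + y) \<le> q x + q y" using CA by (intro sublinearD) (auto simp: A_def)
          ultimately show ?thesis using u_le[of q "x + y"] by (smt (verit))
        qed
        have "u (x + y) - q2 y \<le> u x" if "q2 \<in> C" for q2
          using * that by (intro le_u) force
        then have "u (x + y) - u x \<le> u y" by (intro le_u) force
        then show "u (x + y) \<le> u x + u y" by simp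
      next
        fix c :: real and x assume c: "c > 0"
        have "(1 / c) * u (c *\<^sub>R x) \<le> u x"
        proof (rule le_u)
          fix q assume q: "q \<in> C"
          then have "u (c *\<^sub>R x) \<le> q (c *\<^sub>R x)" by (rule u_le)
          also have "\<dots> \<le> c * q x" using q CA c by (auto simp: A_def sublinear_def)
          finally show "(1 / c) * u (c *\<^sub>R x) \<le> q x" using c by (simp add: field_simps)
        qed
        then show "u (c *\<^sub>R x) \<le> c * u x" using c by (simp add: field_simps)
      next
        have "q 0 = 0" if "q \<in> C" for q using that CA by (auto simp: A_def sublinear_def)
        then show "u 0 = 0" using ne u_le[of _ 0] le_u[of 0 0] by (intro antisym) fastforce+
      qed
      moreover have "u x \<le> p x" for x
        using ne CA u_le order_trans unfolding A_def by blast
      ultimately have "u \<in> A" by (auto simp: A_def)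
      then show ?thesis using u_le by (auto simp: P_def)
    qed
  qed
  then obtain m where m: "m \<in> A" "\<And>a. a \<in> A \<Longrightarrow> P m a \<Longrightarrow> a = m" by blast
  have "linear m"
  proof (rule minimal_sublinear_imp_linear)
    show "sublinear m" using m by (auto simp: A_def)
    fix q assume q: "sublinear q" "\<And>x. q x \<le> m x"
    then have "q \<in> A" using m(1) by (auto simp: A_def intro: order_trans)
    then show "q = m" using m(2) q(2) by (auto simp: P_def)
  qed
  then show ?thesis using that m(1) by (auto simp: A_def)
qed

lemma exists_norming_functional:
  fixes x :: "'a::real_normed_vector"
  obtains h :: "'a \<Rightarrow>\<^sub>L real" where "norm h \<le> 1" "blinfun_apply h x = norm x"
proof -
  have "sublinear (norm :: 'a \<Rightarrow> real)" by (auto simp: sublinear_def norm_triangle_ineq)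
  then obtain q where q: "sublinear q" "\<And>y. q y \<le> norm y" "\<And>y. q y \<le> norm (y + x) - norm x"
    using sublinear_lower_in_direction by blast
  \<comment> \<open>q (- x) \<le> - norm x, which a linear minorant of q turns into norm x \<le> f x\<close>
  obtain f where f: "linear f" "\<And>y. f y \<le> q y" using sublinear_dominates_linear[OF q(1)] by blast
  have neg: "f (- y) = - f y" for y using f(1) by (simp add: linear_neg)
  have le: "f y \<le> norm y" for y using f(2)[of y] q(2)[of y] by simp
  have abs: "norm (f y) \<le> 1 * norm y" for y
    using le[of y] le[of "- y"] neg[of y] by simp
  have bl: "bounded_linear f"
    using f(1) abs by (intro linear_conv_bounded_linear[THEN iffD1] bounded_linear_intro[where K=1])
      (auto simp: linear_add linear_scale mult.commute)
  have "f x = norm x"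
    using f(2)[of "- x"] q(3)[of "- x"] neg[of x] le[of x] by simp
  then show ?thesis
    using that[of "Blinfun f"] bl abs norm_blinfun_bound[of 1 "Blinfun f"]
    by (simp add: bounded_linear_Blinfun_apply)
qed

text \<open>
  Norming functionals of the points of a countable dense set already recover the whole norm,
  because both sides are 1-Lipschitz. This is where separability enters: everything that
  follows is tested against these countably many functionals.
\<close>

lemma exists_countable_norming_family:
  obtains h :: "nat \<Rightarrow> 'a::{real_normed_vector, second_countable_topology} \<Rightarrow>\<^sub>L real"
  where "\<And>j. norm (h j) \<le> 1" "\<And>x. norm x = (SUP j. blinfun_apply (h j) x)"
    "\<And>x. bdd_above (range (\<lambda>j. blinfun_apply (h j) x))"
proof -
  obtain D :: "'a set" where D: "countable D" "\<And>X. open X \<Longrightarrow> X \<noteq> {} \<Longrightarrow> \<exists>d\<in>D. d \<in> X"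
    by (rule countable_dense_setE) blast
  have "D \<noteq> {}" using D(2)[of UNIV] by auto
  have "\<exists>h :: 'a \<Rightarrow>\<^sub>L real. norm h \<le> 1 \<and> blinfun_apply h x = norm x" for x
    using exists_norming_functional by metis
  then obtain F :: "'a \<Rightarrow> 'a \<Rightarrow>\<^sub>L real" where F: "\<And>x. norm (F x) \<le> 1" "\<And>x. blinfun_apply (F x) x = norm x"
    by metis
  define h where "h j = F (from_nat_into D j)" for j
  have n: "norm (h j) \<le> 1" for j by (simp add: h_def F)
  have le: "blinfun_apply (h j) x \<le> norm x" for j x
    using norm_blinfun[of "h j" x] mult_right_mono[OF n[of j], of "norm x"] by simp
  have bdd: "bdd_above (range (\<lambda>j. blinfun_apply (h j) x))" for x
    using le by (intro bdd_aboveI2[where M="norm x"])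
  have "norm x = (SUP j. blinfun_apply (h j) x)" for x
  proof (rule antisym)
    show "(SUP j. blinfun_apply (h j) x) \<le> norm x" by (rule cSUP_least) (auto simp: le)
    show "norm x \<le> (SUP j. blinfun_apply (h j) x)"
    proof (rule field_le_epsilon)
      fix e :: real assume e: "e > 0"
      obtain d where d: "d \<in> D" "d \<in> ball x (e / 2)" using D(2)[of "ball x (e/2)"] e by auto
      obtain j where j: "from_nat_into D j = d"
        using from_nat_into_surj[OF D(1) d(1)] by blast
      have "norm x \<le> norm d + norm (x - d)" using norm_triangle_sub by blast
      also have "norm d = h j d" by (simp add: h_def j F)
      also have "\<dots> = h j x - h j (x - d)" by (simp add: blinfun.diff_right)
      also have "\<dots> \<le> h j x + norm (x - d)"
        using le[of j "d - x"] by (simp add: blinfun.diff_right norm_minus_commute)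
      finally have "norm x \<le> h j x + e" using d(2) by (simp add: dist_norm)
      also have "h j x \<le> (SUP j. blinfun_apply (h j) x)" by (rule cSUP_upper[OF _ bdd]) simp
      finally show "norm x \<le> (SUP j. blinfun_apply (h j) x) + e" by simp
    qed
  qed
  then show ?thesis using that n bdd by blast
qed

section \<open>Measures determined by their characteristic functional\<close>

lemma borel_measurable_blinfun_apply [measurable]: "blinfun_apply g \<in> borel_measurable borel"
  by (intro borel_measurable_continuous_onI continuous_intros)

lemma borel_measurable_cis [measurable]: "cis \<in> borel_measurable borel"
  by (intro borel_measurable_continuous_onI continuous_intros)

text \<open>
  With a countable norming family the distance to a fixed point is a countable supremum of
  measurable functions, and an open set is a countable union of balls.
\<close>

lemma borel_measurable_if_functionals_measurable:
  fixes f :: "'b \<Rightarrow> 'a::{real_normed_vector, second_countable_topology}"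
  assumes f: "\<And>g :: 'a \<Rightarrow>\<^sub>L real. (\<lambda>x. blinfun_apply g (f x)) \<in> borel_measurable M"
  shows "f \<in> borel_measurable M"
proof (rule borel_measurableI)
  fix S :: "'a set" assume S: "open S"
  obtain h :: "nat \<Rightarrow> 'a \<Rightarrow>\<^sub>L real" where h:
    "\<And>x. norm x = (SUP j. blinfun_apply (h j) x)" "\<And>x. bdd_above (range (\<lambda>j. blinfun_apply (h j) x))"
    using exists_countable_norming_family by metis
  have [measurable]: "(\<lambda>x. norm (f x - d)) \<in> borel_measurable M" for d
    unfolding h(1)
    by (intro borel_measurable_cSUP) (use f h(2) in \<open>simp, simp add: blinfun.diff_right, simp\<close>)
  obtain D :: "'a set" where D: "countable D" "\<And>X. open X \<Longrightarrow> X \<noteq> {} \<Longrightarrow> \<exists>d\<in>D. d \<in> X"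
    by (rule countable_dense_setE) blast
  define J where "J = {(d, n). d \<in> D \<and> ball d (inverse (Suc n)) \<subseteq> S}"
  have "countable J"
    by (rule countable_subset[of _ "D \<times> UNIV"]) (auto simp: J_def D)
  have "\<exists>(d, n)\<in>J. norm (y - d) < inverse (Suc n)" if y: "y \<in> S" for y
  proof -
    obtain e where e: "e > 0" "ball y e \<subseteq> S" by (rule openE[OF S y])
    obtain n where n: "inverse (real (Suc n)) < e / 2" using reals_Archimedean[of "e / 2"] e(1) by auto
    obtain d where d: "d \<in> D" "d \<in> ball y (inverse (Suc n))"
      using D(2)[of "ball y (inverse (Suc n))"] by force
    have "ball d (inverse (Suc n)) \<subseteq> ball y e"
    proof
      fix z assume "z \<in> ball d (inverse (Suc n))"
      then have "dist y z < inverse (Suc n) + inverse (Suc n)"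
        using d(2) dist_triangle[of y z d] unfolding mem_ball by linarith
      then show "z \<in> ball y e" using n by simp
    qed
    then have "(d, n) \<in> J" using d e by (auto simp: J_def)
    then show ?thesis using d by (intro bexI[of _ "(d, n)"]) (auto simp: dist_norm)
  qed
  then have "f -` S \<inter> space M = (\<Union>(d, n)\<in>J. {x \<in> space M. norm (f x - d) < inverse (Suc n)})"
    by (fastforce simp: J_def dist_norm norm_minus_commute subset_iff)
  also have "\<dots> \<in> sets M"
    by (intro sets.countable_UN'' \<open>countable J\<close>) (auto simp: case_prod_beta)
  finally show "f -` S \<inter> space M \<in> sets M" .
qed

text \<open>
  Levy's uniqueness theorem for probability measures, rescaled by the common total mass that
  the two characteristic functions have at zero.
\<close>

lemma finite_measure_eq_if_char_eq:
  fixes M N :: "real measure"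
  assumes "finite_measure M" "finite_measure N" and [measurable_cong]: "sets M = sets borel" "sets N = sets borel"
    and eq: "\<And>t. (\<integral>x. cis (t * x) \<partial>M) = (\<integral>x. cis (t * x) \<partial>N)"
  shows "M = N"
proof -
  interpret M: finite_measure M by fact
  interpret N: finite_measure N by fact
  have sp: "space M = UNIV" "space N = UNIV" using assms(3,4)[THEN sets_eq_imp_space_eq] by auto
  define c where "c = measure M UNIV"
  have c: "measure M UNIV = c" "measure N UNIV = c"
    using eq[of 0] sp by (auto simp: c_def)
  show ?thesis
  proof (cases "c = 0")
    case True
    have "emeasure M A = emeasure N A" for A
      using True c M.bounded_measure[of A] N.bounded_measure[of A] sp
        measure_nonneg[of M A] measure_nonneg[of N A]
      unfolding M.emeasure_eq_measure N.emeasure_eq_measure by simp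
    then show ?thesis by (intro measure_eqI) (simp_all add: assms)
  next
    case False
    then have cpos: "c > 0" by (simp add: c_def order_less_le)
    define M' where "M' = density M (\<lambda>_. ennreal (1 / c))"
    define N' where "N' = density N (\<lambda>_. ennreal (1 / c))"
    have em: "emeasure M' A = ennreal (1 / c) * emeasure M A"
      "emeasure N' A = ennreal (1 / c) * emeasure N A" if "A \<in> sets borel" for A
      using that unfolding M'_def N'_def by (simp_all add: emeasure_density_const assms)
    have one: "ennreal (1 / c) * ennreal c = 1"
      using cpos by (simp flip: ennreal_mult)
    have "real_distribution M'" "real_distribution N'"
      unfolding real_distribution_def real_distribution_axioms_def
      using em[of UNIV] one c sp
      by (auto intro!: prob_spaceI simp: M.emeasure_eq_measure N.emeasure_eq_measure M'_def N'_def assms)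
    moreover have "char M' = char N'"
      unfolding char_def M'_def N'_def using eq cpos
      by (auto simp: integral_density cis_conv_exp intro!: ext)
    ultimately have "M' = N'" by (rule Levy_uniqueness)
    then have "ennreal (1 / c) * emeasure M A = ennreal (1 / c) * emeasure N A" if "A \<in> sets borel" for A
      using em that by metis
    then show ?thesis
      using cpos assms(3,4) by (intro measure_eqI) (auto simp: ennreal_mult_cancel_left)
  qed
qed

text \<open>
  Cylinders are built one functional at a time, so that the uniqueness theorem can be proved
  by adding a single real coordinate in each step.
\<close>

inductive cylinder :: "'a::real_normed_vector set \<Rightarrow> bool" where
  cylinder_UNIV: "cylinder UNIV"
| cylinder_Int_vimage: "cylinder S \<Longrightarrow> A \<in> sets borel \<Longrightarrow> cylinder (S \<inter> blinfun_apply (g :: 'a \<Rightarrow>\<^sub>L real) -` A)"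

lemma cylinder_Int: "cylinder T \<Longrightarrow> cylinder S \<Longrightarrow> cylinder (S \<inter> T)"
proof (induction T rule: cylinder.induct)
  case (cylinder_Int_vimage T A g)
  then have "cylinder ((S \<inter> T) \<inter> blinfun_apply g -` A)" by (intro cylinder.intros) auto
  then show ?case by (simp add: Int_assoc)
qed simp

lemma cylinder_borel: "cylinder S \<Longrightarrow> S \<in> sets borel"
proof (induction S rule: cylinder.induct)
  case (cylinder_Int_vimage S A g)
  have "blinfun_apply g -` A \<inter> space borel \<in> sets borel"
    using cylinder_Int_vimage by (intro measurable_sets[of _ borel borel]) auto
  then show ?case using cylinder_Int_vimage by auto
qed simp

lemma sets_borel_eq_cylinders:
  "sets (borel :: 'a::{real_normed_vector, second_countable_topology} measure) = sigma_sets UNIV (Collect cylinder)"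
proof
  let ?N = "sigma UNIV (Collect cylinder :: 'a set set)"
  have "(\<lambda>x. x) \<in> borel_measurable ?N"
  proof (rule borel_measurable_if_functionals_measurable, rule measurableI)
    fix g :: "'a \<Rightarrow>\<^sub>L real" and A :: "real set" assume A: "A \<in> sets borel"
    have "cylinder (UNIV \<inter> blinfun_apply g -` A)" using A by (intro cylinder.intros)
    then show "blinfun_apply g -` A \<inter> space ?N \<in> sets ?N" by simp
  qed simp
  then show "sets (borel :: 'a measure) \<subseteq> sigma_sets UNIV (Collect cylinder)"
    by (auto dest: measurable_sets)
  show "sigma_sets UNIV (Collect cylinder) \<subseteq> sets (borel :: 'a measure)"
    using cylinder_borel sets.sigma_sets_subset[of "Collect cylinder" "borel :: 'a measure"] by auto
qed

lemma finite_measure_integrable_cis: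
  assumes "finite_measure M" "f \<in> borel_measurable M" "S \<in> sets M"
  shows "integrable M (\<lambda>x. indicator S x *\<^sub>R cis (f x))"
proof -
  interpret finite_measure M by fact
  have [measurable]: "f \<in> borel_measurable M" "S \<in> sets M" by fact+
  show ?thesis by (intro integrable_const_bound[of _ 1]) (auto simp: indicator_def)
qed

text \<open>
  A nonnegative substitute for the complex density cis h: multiplying a measure by it leaves
  a finite positive measure, to which the one-dimensional uniqueness theorem applies, while
  its Fourier transform is still a combination of values of the characteristic functional of
  the original measure. The phase makes it possible to recover both the real and the
  imaginary part of cis h.
\<close>

definition cosine_weight :: "'a set \<Rightarrow> ('a::real_normed_vector \<Rightarrow>\<^sub>L real) \<Rightarrow> real \<Rightarrow> 'a \<Rightarrow> real" where
  "cosine_weight S h \<theta> x = indicator S x * (1 + cos (blinfun_apply h x + \<theta>))"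

lemma cosine_weight_nonneg: "0 \<le> cosine_weight S h \<theta> x"
proof -
  have "0 \<le> 1 + cos (blinfun_apply h x + \<theta>)"
    using cos_ge_minus_one[of "blinfun_apply h x + \<theta>"] by linarith
  then show ?thesis by (simp add: cosine_weight_def)
qed

lemma cosine_weight_le_2: "cosine_weight S h \<theta> x \<le> 2"
  by (auto simp: cosine_weight_def indicator_def)

lemma cosine_weight_measurable [measurable]:
  assumes [measurable]: "S \<in> sets borel"
  shows "cosine_weight S h \<theta> \<in> borel_measurable borel"
  unfolding cosine_weight_def[abs_def] by measurable

lemma cosine_weight_times_cis:
  "cosine_weight S h \<theta> x *\<^sub>R cis (t * blinfun_apply g x) =
      indicator S x *\<^sub>R cis (blinfun_apply (t *\<^sub>R g) x)
       + cis \<theta> / 2 * (indicator S x *\<^sub>R cis (blinfun_apply (t *\<^sub>R g + h) x))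
       + cis (- \<theta>) / 2 * (indicator S x *\<^sub>R cis (blinfun_apply (t *\<^sub>R g - h) x))"
proof -
  have cos: "complex_of_real (cos a) = (cis a + cis (- a)) / 2" for a
    by (simp add: complex_eq_iff)
  define a b where "a = t * blinfun_apply g x" and "b = blinfun_apply h x"
  have e1: "cis (b + \<theta>) * cis a = cis \<theta> * cis (a + b)"
    by (simp only: cis_mult) (simp add: algebra_simps)
  have e2: "cis (- (b + \<theta>)) * cis a = cis (- \<theta>) * cis (a - b)"
    by (simp only: cis_mult) (simp add: algebra_simps)
  have "(1 + complex_of_real (cos (b + \<theta>))) * cis a
      = cis a + cis (b + \<theta>) * cis a / 2 + cis (- (b + \<theta>)) * cis a / 2"
    unfolding cos by (simp only: distrib_right add_divide_distrib mult_1_left times_divide_eq_left)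
      (simp only: add.assoc)
  then have "(1 + complex_of_real (cos (b + \<theta>))) * cis a
      = cis a + cis \<theta> * cis (a + b) / 2 + cis (- \<theta>) * cis (a - b) / 2"
    unfolding e1 e2 .
  then show ?thesis
    unfolding cosine_weight_def blinfun.add_left blinfun.diff_left blinfun.scaleR_left
        a_def[symmetric] b_def[symmetric] scaleR_conv_of_real
    by (cases "x \<in> S") (simp_all add: a_def)
qed

definition tilted_law ::
    "'a::real_normed_vector measure \<Rightarrow> 'a set \<Rightarrow> ('a \<Rightarrow>\<^sub>L real) \<Rightarrow> real \<Rightarrow> ('a \<Rightarrow>\<^sub>L real) \<Rightarrow> real measure" where
  "tilted_law K S h \<theta> g = distr (density K (\<lambda>x. ennreal (cosine_weight S h \<theta> x))) borel (blinfun_apply g)"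

lemma finite_measure_tilted_law:
  assumes "finite_measure K" and [measurable_cong]: "sets K = sets borel" and [measurable]: "S \<in> sets borel"
  shows "finite_measure (tilted_law K S h \<theta> g)"
proof -
  interpret K: finite_measure K by fact
  have "(\<integral>\<^sup>+x. ennreal (cosine_weight S h \<theta> x) \<partial>K) \<le> (\<integral>\<^sup>+x. ennreal 2 \<partial>K)"
    by (intro nn_integral_mono ennreal_leI cosine_weight_le_2)
  also have "\<dots> < \<infinity>" by (simp add: less_top[symmetric] ennreal_mult_eq_top_iff)
  finally have "finite_measure (density K (\<lambda>x. ennreal (cosine_weight S h \<theta> x)))"
    by (intro finite_measureI) (simp add: emeasure_density cong: nn_integral_cong)
  then show ?thesis unfolding tilted_law_def by (rule finite_measure.finite_measure_distr) simp
qed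

lemma integral_tilted_law:
  fixes \<phi> :: "real \<Rightarrow> complex"
  assumes [measurable_cong]: "sets K = sets borel" and [measurable]: "S \<in> sets borel" "\<phi> \<in> borel_measurable borel"
  shows "(\<integral>y. \<phi> y \<partial>tilted_law K S h \<theta> g) = (\<integral>x. cosine_weight S h \<theta> x *\<^sub>R \<phi> (blinfun_apply g x) \<partial>K)"
  unfolding tilted_law_def
  by (subst integral_distr, simp, simp, subst integral_density) (simp_all add: cosine_weight_nonneg)

lemma char_tilted_law:
  assumes K: "finite_measure K" and [measurable_cong]: "sets K = sets borel" and [measurable]: "S \<in> sets borel"
  shows "(\<integral>y. cis (t * y) \<partial>tilted_law K S h \<theta> g) =
       (\<integral>x. indicator S x *\<^sub>R cis (blinfun_apply (t *\<^sub>R g) x) \<partial>K)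
       + cis \<theta> / 2 * (\<integral>x. indicator S x *\<^sub>R cis (blinfun_apply (t *\<^sub>R g + h) x) \<partial>K)
       + cis (- \<theta>) / 2 * (\<integral>x. indicator S x *\<^sub>R cis (blinfun_apply (t *\<^sub>R g - h) x) \<partial>K)"
proof -
  have I: "integrable K (\<lambda>x. indicator S x *\<^sub>R cis (blinfun_apply f x))" for f
    by (intro finite_measure_integrable_cis K) measurable
  have "(\<integral>y. cis (t * y) \<partial>tilted_law K S h \<theta> g)
      = (\<integral>x. cosine_weight S h \<theta> x *\<^sub>R cis (t * blinfun_apply g x) \<partial>K)"
    by (rule integral_tilted_law) (use assms in measurable)
  also have "\<dots> = (\<integral>x. indicator S x *\<^sub>R cis (blinfun_apply (t *\<^sub>R g) x)
       + cis \<theta> / 2 * (indicator S x *\<^sub>R cis (blinfun_apply (t *\<^sub>R g + h) x))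
       + cis (- \<theta>) / 2 * (indicator S x *\<^sub>R cis (blinfun_apply (t *\<^sub>R g - h) x)) \<partial>K)"
    by (simp only: cosine_weight_times_cis)
  also have "\<dots> = (\<integral>x. indicator S x *\<^sub>R cis (blinfun_apply (t *\<^sub>R g) x) \<partial>K)
       + cis \<theta> / 2 * (\<integral>x. indicator S x *\<^sub>R cis (blinfun_apply (t *\<^sub>R g + h) x) \<partial>K)
       + cis (- \<theta>) / 2 * (\<integral>x. indicator S x *\<^sub>R cis (blinfun_apply (t *\<^sub>R g - h) x) \<partial>K)"
    by (simp only: I Bochner_Integration.integral_add Bochner_Integration.integrable_add
          integrable_mult_right integral_mult_right_zero)
  finally show ?thesis .
qed

text \<open>
  The phases 0 and \<pi> cancel the cosines and leave the constant 2; the phases 0 and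
  -\<pi>/2 supply the cosine and the sine of h.
\<close>

lemma cosine_weight_combinations:
  fixes S :: "'a::real_normed_vector set" and A :: "real set" and x :: 'a and g h :: "'a::real_normed_vector \<Rightarrow>\<^sub>L real"
  defines "T \<equiv> S \<inter> blinfun_apply g -` A" and "w \<equiv> cosine_weight S h"
  shows "w 0 x *\<^sub>R indicator A (blinfun_apply g x) + w pi x *\<^sub>R indicator A (blinfun_apply g x)
      = 2 * (indicator T x :: complex)" (is ?thesis1)
    and "indicator T x *\<^sub>R cis (blinfun_apply h x) = w 0 x *\<^sub>R indicator A (blinfun_apply g x)
         + \<i> * (w (- pi / 2) x *\<^sub>R indicator A (blinfun_apply g x))
         - (1 + \<i>) * (indicator T x)" (is ?thesis2)
proof -
  have "cos (b + - pi / 2) = sin b" for b :: real by (simp add: cos_diff)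
  then have w: "w 0 x = 1 + cos (blinfun_apply h x)" "w pi x = 1 - cos (blinfun_apply h x)"
    "w (- pi / 2) x = 1 + sin (blinfun_apply h x)" if "x \<in> S"
    using that by (simp_all add: w_def cosine_weight_def)
  have "?thesis1 \<and> ?thesis2"
  proof (cases "x \<in> S \<and> blinfun_apply g x \<in> A")
    case True
    then have "indicator T x = (1::complex)" "indicator T x = (1::real)" "indicator A (blinfun_apply g x) = (1::complex)"
      by (simp_all add: T_def)
    then show ?thesis using w True by (simp add: complex_eq_iff)
  next
    case False
    then have "indicator T x = (0::complex)" "indicator T x = (0::real)" by (auto simp: T_def)
    moreover have "w \<theta> x *\<^sub>R indicator A (blinfun_apply g x) = (0 :: complex)" for \<theta>
      using False by (auto simp: w_def cosine_weight_def indicator_def)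
    ultimately show ?thesis by (simp only: add_0_left mult_zero_right mult_zero_left scale_zero_left diff_self)
  qed
  then show ?thesis1 ?thesis2 by auto
qed

lemma integral_cylinder_step:
  fixes S :: "'a::real_normed_vector set" and A :: "real set" and K :: "'a::real_normed_vector measure" and g h :: "'a \<Rightarrow>\<^sub>L real"
  assumes "finite_measure K" and [measurable_cong]: "sets K = sets borel"
    and [measurable]: "S \<in> sets borel" "A \<in> sets borel"
  defines "T \<equiv> S \<inter> blinfun_apply g -` A"
    and "J \<theta> \<equiv> (\<integral>y. indicator A y \<partial>tilted_law K S h \<theta> g)"
  shows "2 * (\<integral>x. (indicator T x :: complex) \<partial>K) = J 0 + J pi"
    and "(\<integral>x. indicator T x *\<^sub>R cis (blinfun_apply h x) \<partial>K)
       = J 0 + \<i> * J (- pi / 2) - (1 + \<i>) * (\<integral>x. indicator T x \<partial>K)"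
proof -
  interpret K: finite_measure K by fact
  have "blinfun_apply g -` A \<inter> space borel \<in> sets borel" by measurable
  then have [measurable]: "T \<in> sets borel" by (simp add: T_def)
  define w where "w = cosine_weight S h"
  have [measurable]: "w \<theta> \<in> borel_measurable borel" for \<theta> unfolding w_def by measurable
  have J: "J \<theta> = (\<integral>x. w \<theta> x *\<^sub>R indicator A (blinfun_apply g x) \<partial>K)" for \<theta>
    unfolding J_def w_def by (rule integral_tilted_law) (use assms in measurable)
  have "norm (w \<theta> x *\<^sub>R indicator A y :: complex) \<le> 2" for \<theta> x y
    using cosine_weight_nonneg[of S h \<theta> x] cosine_weight_le_2[of S h \<theta> x]
    by (simp add: w_def indicator_def)
  then have IW: "integrable K (\<lambda>x. w \<theta> x *\<^sub>R indicator A (blinfun_apply g x) :: complex)" for \<theta>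
    by (intro K.integrable_const_bound[of _ 2]) simp_all
  have IT: "integrable K (\<lambda>x. indicator T x :: complex)"
    by (intro K.integrable_const_bound[of _ 1]) (auto simp: indicator_def)
  show "2 * (\<integral>x. (indicator T x :: complex) \<partial>K) = J 0 + J pi"
    unfolding J
    by (subst Bochner_Integration.integral_add[symmetric, OF IW IW])
       (simp only: w_def cosine_weight_combinations integral_mult_right_zero T_def)
  have "(\<integral>x. indicator T x *\<^sub>R cis (blinfun_apply h x) \<partial>K)
      = (\<integral>x. w 0 x *\<^sub>R indicator A (blinfun_apply g x)
         + \<i> * (w (- pi / 2) x *\<^sub>R indicator A (blinfun_apply g x))
         - (1 + \<i>) * (indicator T x) \<partial>K)"
    unfolding w_def T_def by (simp only: cosine_weight_combinations)
  also have "\<dots> = J 0 + \<i> * J (- pi / 2) - (1 + \<i>) * (\<integral>x. indicator T x \<partial>K)"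
    unfolding J
    by (simp only: IW IT Bochner_Integration.integral_add Bochner_Integration.integrable_add
          Bochner_Integration.integral_diff integrable_mult_right integral_mult_right_zero)
  finally show "(\<integral>x. indicator T x *\<^sub>R cis (blinfun_apply h x) \<partial>K)
       = J 0 + \<i> * J (- pi / 2) - (1 + \<i>) * (\<integral>x. indicator T x \<partial>K)" .
qed

text \<open>
  The Cramer--Wold principle without multivariate Fourier analysis. Knowing all integrals of
  cis h over a cylinder S determines the Fourier transform, hence the law, of one further
  functional g under the weighted restrictions to S; integrating this law over a Borel set
  gives the integrals of cis h over the next cylinder.
\<close>

lemma char_on_cylinders_eq:
  fixes M N :: "'a::real_normed_vector measure"
  assumes M: "finite_measure M" "sets M = sets borel" and N: "finite_measure N" "sets N = sets borel"
    and eq: "\<And>f :: 'a \<Rightarrow>\<^sub>L real. (\<integral>x. cis (f x) \<partial>M) = (\<integral>x. cis (f x) \<partial>N)"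
    and "cylinder S"
  shows "(\<integral>x. indicator S x *\<^sub>R cis (blinfun_apply h x) \<partial>M) = (\<integral>x. indicator S x *\<^sub>R cis (blinfun_apply h x) \<partial>N)"
  using \<open>cylinder S\<close>
proof (induction S arbitrary: h rule: cylinder.induct)
  case cylinder_UNIV
  show ?case using eq[of h] by simp
next
  case (cylinder_Int_vimage S A g)
  note S = cylinder_borel[OF cylinder_Int_vimage.hyps(1)] and A = cylinder_Int_vimage.hyps(2)
  have "tilted_law M S h \<theta> g = tilted_law N S h \<theta> g" for \<theta>
  proof (rule finite_measure_eq_if_char_eq)
    show "(\<integral>y. cis (t * y) \<partial>tilted_law M S h \<theta> g) = (\<integral>y. cis (t * y) \<partial>tilted_law N S h \<theta> g)" for t
      unfolding char_tilted_law[OF M S] char_tilted_law[OF N S] cylinder_Int_vimage.IH ..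
    show "finite_measure (tilted_law M S h \<theta> g)" "finite_measure (tilted_law N S h \<theta> g)"
      by (intro finite_measure_tilted_law M N S)+
  qed (simp_all add: tilted_law_def)
  moreover from this have "(\<integral>x. (indicator (S \<inter> blinfun_apply g -` A) x :: complex) \<partial>M)
      = (\<integral>x. indicator (S \<inter> blinfun_apply g -` A) x \<partial>N)"
    using integral_cylinder_step(1)[OF M S A, of g h] integral_cylinder_step(1)[OF N S A, of g h]
    by (metis mult_left_cancel zero_neq_numeral)
  ultimately show ?case
    using integral_cylinder_step(2)[OF M S A, of g h] integral_cylinder_step(2)[OF N S A, of g h] by simp
qed

text \<open>
  The cylinders are stable under intersection and generate the Borel sets, and taking h = 0
  in the preceding lemma evaluates both measures on them.
\<close>

theorem borel_measure_eqI_char_functional: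
  fixes M N :: "'a::{real_normed_vector, second_countable_topology} measure"
  assumes "finite_measure M" "sets M = sets borel" "finite_measure N" "sets N = sets borel"
    and eq: "\<And>f :: 'a \<Rightarrow>\<^sub>L real. (\<integral>x. cis (f x) \<partial>M) = (\<integral>x. cis (f x) \<partial>N)"
  shows "M = N"
proof (rule measure_eqI_generator_eq)
  interpret M: finite_measure M by fact
  interpret N: finite_measure N by fact
  show "Int_stable (Collect cylinder :: 'a set set)"
    by (auto simp: Int_stable_def intro: cylinder_Int)
  show "sets M = sigma_sets UNIV (Collect cylinder)" "sets N = sigma_sets UNIV (Collect cylinder)"
    using assms sets_borel_eq_cylinders by auto
  show "range (\<lambda>_::nat. UNIV) \<subseteq> (Collect cylinder :: 'a set set)" by (auto intro: cylinder_UNIV)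
  fix S :: "'a set" assume "S \<in> Collect cylinder"
  then have S: "cylinder S" "S \<in> sets borel" by (auto intro: cylinder_borel)
  have "complex_of_real (measure M S) = complex_of_real (measure N S)"
    using char_on_cylinders_eq[OF assms S(1), of 0] S(2)
    by (simp add: assms scaleR_conv_of_real)
  then show "emeasure M S = emeasure N S"
    by (simp add: M.emeasure_eq_measure N.emeasure_eq_measure)
qed (use assms in \<open>auto simp: finite_measure.emeasure_finite\<close>)

section \<open>Gaussian measures and their characteristic functionals\<close>

lemma std_normal_prob_space: "prob_space std_normal_distribution"
  using real_dist_normal_dist by (simp add: real_distribution_def)

lemma distr_std_normal_eq_density:
  assumes "\<sigma> > 0"
  shows "distr std_normal_distribution borel (\<lambda>z. a + \<sigma> * z)
    = density lborel (\<lambda>x. ennreal (normal_density a \<sigma> x))"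
proof -
  interpret prob_space std_normal_distribution by (rule std_normal_prob_space)
  have "distributed std_normal_distribution lborel (\<lambda>z. z) (normal_density 0 1)"
    by (auto simp: distributed_def intro!: measure_eqI simp: emeasure_distr)
  then have "distributed std_normal_distribution lborel (\<lambda>z. a + \<sigma> * z) (normal_density (a + \<sigma> * 0) (\<bar>\<sigma>\<bar> * 1))"
    using assms by (intro normal_density_affine) auto
  then have "distr std_normal_distribution lborel (\<lambda>z. a + \<sigma> * z) = density lborel (normal_density a \<sigma>)"
    using assms by (simp add: distributed_distr_eq_density)
  moreover have "distr std_normal_distribution lborel (\<lambda>z. a + \<sigma> * z) = distr std_normal_distribution borel (\<lambda>z. a + \<sigma> * z)"
    by (rule distr_cong) simp_all
  ultimately show ?thesis by simp
qed

text \<open>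
  Dirac measures and nondegenerate normal laws are treated uniformly as affine images of the
  standard normal law, the Dirac case being \<sigma> = 0.
\<close>

lemma gaussian_real_iff_affine_std_normal:
  "gaussian_real M \<longleftrightarrow> (\<exists>a \<sigma>. \<sigma> \<ge> 0 \<and> M = distr std_normal_distribution borel (\<lambda>z. a + \<sigma> * z))"
proof -
  interpret prob_space std_normal_distribution by (rule std_normal_prob_space)
  have 0: "distr std_normal_distribution borel (\<lambda>z. a + 0 * z) = return borel a" for a :: real
    by (simp add: distr_const)
  show ?thesis
    unfolding gaussian_real_def
    using 0 distr_std_normal_eq_density by (metis order_le_less order_refl)
qed

lemma affine_std_normal_moments:
  fixes a \<sigma> :: real
  defines "N \<equiv> distr std_normal_distribution borel (\<lambda>z. a + \<sigma> * z)"
  shows "has_bochner_integral N (\<lambda>x. x) a"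
    and "has_bochner_integral N (\<lambda>x. (x - a)\<^sup>2) (\<sigma>\<^sup>2)"
    and "(\<integral>x. cis (t * x) \<partial>N) = cis (t * a) * exp (- (t\<^sup>2 * \<sigma>\<^sup>2) / 2)"
proof -
  interpret prob_space std_normal_distribution by (rule std_normal_prob_space)
  have m1: "has_bochner_integral std_normal_distribution (\<lambda>z. z) 0"
    using integrable_std_normal_distribution_moment[of 1] integral_std_normal_distribution_moment_odd[of 1]
    by (simp add: has_bochner_integral_iff)
  have m2: "has_bochner_integral std_normal_distribution (\<lambda>z. z\<^sup>2) 1"
    using std_normal_distribution_even_moments[of 1] integrable_std_normal_distribution_moment[of 2]
    by (simp add: has_bochner_integral_iff fact_numeral)
  have "has_bochner_integral std_normal_distribution (\<lambda>z. a + \<sigma> * z) (a + \<sigma> * 0)"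
    using m1 prob_space by (intro has_bochner_integral_add has_bochner_integral_mult_right)
      (simp_all add: has_bochner_integral_iff)
  then show "has_bochner_integral N (\<lambda>x. x) a"
    unfolding N_def by (simp add: has_bochner_integral_distr)
  have "has_bochner_integral std_normal_distribution (\<lambda>z. \<sigma>\<^sup>2 * z\<^sup>2) (\<sigma>\<^sup>2 * 1)"
    using m2 by (intro has_bochner_integral_mult_right)
  then show "has_bochner_integral N (\<lambda>x. (x - a)\<^sup>2) (\<sigma>\<^sup>2)"
    unfolding N_def by (simp add: has_bochner_integral_distr power_mult_distrib)
  have "(\<integral>x. cis (t * x) \<partial>N) = (\<integral>z. cis (t * a) * cis ((t * \<sigma>) * z) \<partial>std_normal_distribution)"
    unfolding N_def by (simp add: integral_distr cis_mult algebra_simps)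
  also have "\<dots> = cis (t * a) * char std_normal_distribution (t * \<sigma>)"
    by (simp add: char_def cis_conv_exp)
  also have "\<dots> = cis (t * a) * exp (- (t\<^sup>2 * \<sigma>\<^sup>2) / 2)"
    by (simp add: char_std_normal_distribution power_mult_distrib exp_of_real)
  finally show "(\<integral>x. cis (t * x) \<partial>N) = cis (t * a) * exp (- (t\<^sup>2 * \<sigma>\<^sup>2) / 2)" .
qed

text \<open>
  Symmetry of C alone makes the form f, g \<mapsto> f (C g) bilinear: linearity in the first
  argument holds by definition of the functionals and is carried over to the second one.
\<close>

locale covariance_form =
  fixes C :: "('a::real_normed_vector \<Rightarrow>\<^sub>L real) \<Rightarrow> 'a"
  assumes symmetric: "blinfun_apply f (C g) = blinfun_apply g (C f)"
    and nonneg: "0 \<le> blinfun_apply f (C f)"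
begin

definition cov :: "('a \<Rightarrow>\<^sub>L real) \<Rightarrow> ('a \<Rightarrow>\<^sub>L real) \<Rightarrow> real" where
  "cov f g = blinfun_apply f (C g)"

lemma cov_commute: "cov f g = cov g f"
  by (simp add: cov_def symmetric)

lemma cov_nonneg: "0 \<le> cov f f"
  by (simp add: cov_def nonneg)

lemma cov_bilinear:
  "cov (f + g) h = cov f h + cov g h" "cov h (f + g) = cov h f + cov h g"
  "cov (f - g) h = cov f h - cov g h" "cov h (f - g) = cov h f - cov h g"
  "cov (c *\<^sub>R f) h = c * cov f h" "cov h (c *\<^sub>R f) = c * cov h f"
  unfolding cov_commute[of h] by (simp_all add: cov_def blinfun.add_left blinfun.diff_left blinfun.scaleR_left)

lemma cov_Cauchy_Schwarz: "(cov f g)\<^sup>2 \<le> cov f f * cov g g"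
proof -
  have q: "0 \<le> cov f f - 2 * t * cov f g + t\<^sup>2 * cov g g" for t
    using cov_nonneg[of "f - t *\<^sub>R g"]
    by (simp add: cov_bilinear cov_commute[of g f] power2_eq_square algebra_simps)
  show ?thesis
  proof (cases "cov g g = 0")
    case True
    have "cov f g = 0"
    proof (rule ccontr)
      assume "cov f g \<noteq> 0"
      then show False using q[of "(cov f f + 1) / (2 * cov f g)"] True by simp
    qed
    then show ?thesis using True by simp
  next
    case False
    then have "0 < cov g g" using cov_nonneg[of g] by simp
    then show ?thesis using q[of "cov f g / cov g g"] by (simp add: field_simps power2_eq_square)
  qed
qed

end

text \<open>
  The description of Gaussian measures that is used in all constructions. Unlike a statement
  about means and covariances it involves only bounded integrands, so that it passes to
  limits by dominated convergence, and it determines the measure.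
\<close>

definition gaussian_with ::
    "'a::{banach, second_countable_topology} measure \<Rightarrow> 'a \<Rightarrow> (('a \<Rightarrow>\<^sub>L real) \<Rightarrow> 'a) \<Rightarrow> bool" where
  "gaussian_with M m C \<longleftrightarrow> prob_space M \<and> sets M = sets borel \<and> covariance_form C \<and>
     (\<forall>f. (\<integral>x. cis (blinfun_apply f x) \<partial>M)
        = cis (blinfun_apply f m) * exp (- blinfun_apply f (C f) / 2))"

lemma gaussian_withI_mean_covariance:
  assumes g: "gaussian_measure M" and m: "is_mean_element M m" and C: "is_covariance_operator M m C"
  shows "gaussian_with M m C"
proof -
  have M: "prob_space M" "sets M = sets borel" using g by (auto simp: gaussian_measure_def)
  note [measurable_cong] = M(2)
  have cov: "has_bochner_integral M (\<lambda>x. (blinfun_apply f x - blinfun_apply f m) * (blinfun_apply h x - blinfun_apply h m))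
      (blinfun_apply h (C f))" for f h
    using C by (simp add: is_covariance_operator_def)
  have "covariance_form C"
  proof
    fix f h :: "'a \<Rightarrow>\<^sub>L real"
    show "blinfun_apply f (C h) = blinfun_apply h (C f)"
      using cov[of h f] cov[of f h] by (simp add: has_bochner_integral_iff mult.commute)
    show "0 \<le> blinfun_apply f (C f)"
      using cov[of f f] by (auto simp: has_bochner_integral_iff dest!: sym[of _ "blinfun_apply f (C f)"])
  qed
  moreover have "(\<integral>x. cis (blinfun_apply f x) \<partial>M) = cis (blinfun_apply f m) * exp (- blinfun_apply f (C f) / 2)" for f
  proof -
    obtain a \<sigma> where d: "distr M borel (blinfun_apply f) = distr std_normal_distribution borel (\<lambda>z. a + \<sigma> * z)"
      using g unfolding gaussian_measure_def gaussian_real_iff_affine_std_normal by blast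
    note mom = affine_std_normal_moments[of a \<sigma>, folded d]
    have "has_bochner_integral M (\<lambda>x. blinfun_apply f x) a"
      using mom(1) by (simp add: has_bochner_integral_iff integrable_distr_eq integral_distr)
    moreover have "has_bochner_integral M (\<lambda>x. blinfun_apply f x) (blinfun_apply f m)"
      using m by (simp add: is_mean_element_def)
    ultimately have a: "a = blinfun_apply f m" by (rule has_bochner_integral_eq)
    have "has_bochner_integral M (\<lambda>x. (blinfun_apply f x - a)\<^sup>2) (\<sigma>\<^sup>2)"
      using mom(2) by (simp add: has_bochner_integral_iff integrable_distr_eq integral_distr)
    moreover have "has_bochner_integral M (\<lambda>x. (blinfun_apply f x - a)\<^sup>2) (blinfun_apply f (C f))"
      using cov[of f f] by (simp add: a power2_eq_square)
    ultimately have s: "\<sigma>\<^sup>2 = blinfun_apply f (C f)" by (rule has_bochner_integral_eq)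
    show ?thesis using mom(3)[of 1] by (simp add: a s integral_distr)
  qed
  ultimately show ?thesis using M by (simp add: gaussian_with_def)
qed

lemma distr_gaussian_with:
  assumes "gaussian_with M m C"
  shows "distr M borel (blinfun_apply f)
    = distr std_normal_distribution borel (\<lambda>z. blinfun_apply f m + sqrt (blinfun_apply f (C f)) * z)" (is "?L = ?R")
proof (rule finite_measure_eq_if_char_eq)
  interpret prob_space M using assms by (simp add: gaussian_with_def)
  interpret S: prob_space std_normal_distribution by (rule std_normal_prob_space)
  interpret C: covariance_form C using assms by (simp add: gaussian_with_def)
  have [measurable_cong]: "sets M = sets borel" using assms by (simp add: gaussian_with_def)
  show "finite_measure ?L" "finite_measure ?R" by (intro finite_measure_distr S.finite_measure_distr; simp)+
  fix t
  have "blinfun_apply (t *\<^sub>R f) (C (t *\<^sub>R f)) = t\<^sup>2 * blinfun_apply f (C f)"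
    using C.cov_bilinear(6)[of f t f] by (simp add: C.cov_def blinfun.scaleR_left power2_eq_square)
  moreover have "(\<integral>x. cis (t * x) \<partial>?L) = (\<integral>x. cis (blinfun_apply (t *\<^sub>R f) x) \<partial>M)"
    by (simp add: integral_distr blinfun.scaleR_left)
  ultimately have "(\<integral>x. cis (t * x) \<partial>?L) = cis (t * blinfun_apply f m) * exp (- (t\<^sup>2 * blinfun_apply f (C f)) / 2)"
    using assms by (simp add: gaussian_with_def blinfun.scaleR_left[of t f m])
  then show "(\<integral>x. cis (t * x) \<partial>?L) = (\<integral>x. cis (t * x) \<partial>?R)"
    by (simp add: affine_std_normal_moments(3) C.nonneg)
qed simp_all

lemma gaussian_measure_if_gaussian_with:
  assumes "gaussian_with M m C"
  shows "gaussian_measure M"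
proof -
  interpret C: covariance_form C using assms by (simp add: gaussian_with_def)
  show ?thesis
    unfolding gaussian_measure_def gaussian_real_iff_affine_std_normal
    using assms distr_gaussian_with[OF assms] C.nonneg real_sqrt_ge_zero
    unfolding gaussian_with_def by metis
qed

lemma gaussian_with_variance:
  assumes "gaussian_with M m C"
  shows "has_bochner_integral M (\<lambda>x. (blinfun_apply f (x - m))\<^sup>2) (blinfun_apply f (C f))"
proof -
  interpret C: covariance_form C using assms by (simp add: gaussian_with_def)
  have [measurable_cong]: "sets M = sets borel" using assms by (simp add: gaussian_with_def)
  show ?thesis
    using affine_std_normal_moments(2)[of "blinfun_apply f m" "sqrt (blinfun_apply f (C f))",
        folded distr_gaussian_with[OF assms]]
    by (simp add: has_bochner_integral_iff integrable_distr_eq integral_distr blinfun.diff_right C.nonneg)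
qed

text \<open>
  A functional of variance zero is almost surely constant; this turns the vanishing residual
  variances of the regression into almost sure identities.
\<close>

lemma gaussian_with_AE_null:
  assumes M: "gaussian_with M m C" and f: "blinfun_apply f (C f) = 0"
  shows "AE x in M. blinfun_apply f (x - m) = 0"
proof -
  have "AE x in M. (blinfun_apply f (x - m))\<^sup>2 = 0"
    using gaussian_with_variance[OF M, of f] f
    by (subst integral_nonneg_eq_0_iff_AE[symmetric]) (auto simp: has_bochner_integral_iff)
  then show ?thesis by simp
qed

lemma gaussian_with_Chebyshev:
  assumes M: "gaussian_with M m C" and e: "e > 0"
  shows "measure M {x. e \<le> \<bar>blinfun_apply f (x - m)\<bar>} \<le> blinfun_apply f (C f) / e\<^sup>2"
proof -
  have "sets M = sets borel" using M by (simp add: gaussian_with_def)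
  then have [simp]: "space M = UNIV" by (auto dest: sets_eq_imp_space_eq)
  have "measure M {x \<in> space M. e\<^sup>2 \<le> (blinfun_apply f (x - m))\<^sup>2} \<le> (\<integral>x. (blinfun_apply f (x - m))\<^sup>2 \<partial>M) / e\<^sup>2"
    using gaussian_with_variance[OF M, of f] e
    by (intro integral_Markov_inequality_measure[where A="{}"]) (auto simp: has_bochner_integral_iff)
  moreover have "e\<^sup>2 \<le> (blinfun_apply f (x - m))\<^sup>2 \<longleftrightarrow> e \<le> \<bar>blinfun_apply f (x - m)\<bar>" for x
    using e by (metis abs_le_square_iff abs_of_pos)
  ultimately show ?thesis
    using gaussian_with_variance[OF M, of f] by (simp add: has_bochner_integral_iff)
qed

lemma gaussian_measure_translate:
  assumes M: "gaussian_with M m C"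
  shows "gaussian_measure (distr M borel (\<lambda>x. a + x))"
proof (rule gaussian_measure_if_gaussian_with)
  interpret prob_space M using assms by (simp add: gaussian_with_def)
  have [measurable_cong]: "sets M = sets borel" using assms by (simp add: gaussian_with_def)
  have "prob_space (distr M borel (\<lambda>x. a + x))" by (rule prob_space_distr) simp
  moreover have "(\<integral>x. cis (blinfun_apply f x) \<partial>distr M borel (\<lambda>x. a + x))
     = cis (blinfun_apply f a) * (\<integral>x. cis (blinfun_apply f x) \<partial>M)" for f
    by (simp add: integral_distr blinfun.add_right cis_mult[symmetric])
  ultimately show "gaussian_with (distr M borel (\<lambda>x. a + x)) (a + m) C"
    using M by (simp add: gaussian_with_def blinfun.add_right mult.assoc cis_mult[symmetric])
qed

section \<open>Finite-rank regression\<close>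

context covariance_form
begin

text \<open>
  The best linear prediction of x from the first n functionals of G x, as an operator of
  finite rank on the range space of G. One step of Gram--Schmidt orthogonalises the next
  functional against the previous ones and adds a term of rank one, whose direction is the
  covariance operator applied to the normalised residual. A residual of variance zero needs
  no case distinction: division by zero turns the whole new term into zero.
\<close>

primrec regression :: "('a \<Rightarrow>\<^sub>L 'b) \<Rightarrow> (nat \<Rightarrow> 'b::real_normed_vector \<Rightarrow>\<^sub>L real) \<Rightarrow> nat \<Rightarrow> 'b \<Rightarrow>\<^sub>L 'a" where
  "regression G g 0 = 0"
| "regression G g (Suc n) =
    (let r = g n - ((g n o\<^sub>L G) o\<^sub>L regression G g n);
         \<eta> = (1 / sqrt (cov (r o\<^sub>L G) (r o\<^sub>L G))) *\<^sub>R r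
     in regression G g n + (blinfun_scaleR_left (C (\<eta> o\<^sub>L G)) o\<^sub>L \<eta>))"

text \<open>
  In terms of the covariance form, the operators P n act on functionals as nested orthogonal
  projections. The increment formula is Pythagoras: step n gains the squared covariance with
  one new direction, and for the functional g n itself that gain is exactly the variance
  which was still unexplained.
\<close>

lemma
  fixes G :: "'a \<Rightarrow>\<^sub>L 'b::real_normed_vector" and g :: "nat \<Rightarrow> 'b \<Rightarrow>\<^sub>L real"
  defines "P \<equiv> \<lambda>n. regression G g n o\<^sub>L G"
  shows regression_orthogonality: "k \<le> n \<Longrightarrow> cov (f o\<^sub>L P n) (h o\<^sub>L P k) = cov (f o\<^sub>L P k) h"
    and regression_increment: "\<exists>\<xi>. (\<forall>f. cov (f o\<^sub>L P (Suc n)) f = cov (f o\<^sub>L P n) f + (cov f \<xi>)\<^sup>2)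
        \<and> (cov (g n o\<^sub>L G) \<xi>)\<^sup>2 = cov (g n o\<^sub>L G) (g n o\<^sub>L G) - cov ((g n o\<^sub>L G) o\<^sub>L P n) (g n o\<^sub>L G)"
proof -
  define a where "a n = g n o\<^sub>L G" for n
  define \<rho> where "\<rho> n = cov (a n - (a n o\<^sub>L P n)) (a n - (a n o\<^sub>L P n))" for n
  define \<xi> where "\<xi> n = (1 / sqrt (\<rho> n)) *\<^sub>R (a n - (a n o\<^sub>L P n))" for n
  have step: "f o\<^sub>L P (Suc n) = (f o\<^sub>L P n) + cov f (\<xi> n) *\<^sub>R \<xi> n" for f n
  proof (rule blinfun_eqI)
    fix x
    define r where "r = g n - ((g n o\<^sub>L G) o\<^sub>L regression G g n)"
    have rG: "r o\<^sub>L G = a n - (a n o\<^sub>L P n)"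
      by (rule blinfun_eqI) (simp add: r_def a_def P_def blinfun.diff_left)
    define \<eta> where "\<eta> = (1 / sqrt (\<rho> n)) *\<^sub>R r"
    have \<xi>: "\<eta> o\<^sub>L G = \<xi> n"
      unfolding \<xi>_def rG[symmetric] by (rule blinfun_eqI) (simp add: \<eta>_def blinfun.scaleR_left)
    have "regression G g (Suc n) = regression G g n + (blinfun_scaleR_left (C (\<xi> n)) o\<^sub>L \<eta>)"
      by (simp add: Let_def r_def[symmetric] rG \<rho>_def[symmetric] \<eta>_def[symmetric] \<xi>)
    then have "blinfun_apply (P (Suc n)) x = blinfun_apply (P n) x + blinfun_apply \<eta> (blinfun_apply G x) *\<^sub>R C (\<xi> n)"
      by (simp add: P_def blinfun.add_left)
    also have "blinfun_apply \<eta> (blinfun_apply G x) = blinfun_apply (\<xi> n) x" by (simp flip: \<xi>)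
    finally show "blinfun_apply (f o\<^sub>L P (Suc n)) x = blinfun_apply ((f o\<^sub>L P n) + cov f (\<xi> n) *\<^sub>R \<xi> n) x"
      by (simp add: blinfun.add_left blinfun.add_right blinfun.scaleR_right blinfun.scaleR_left cov_def)
  qed
  \<comment> \<open>\<xi> n has variance one or is zero\<close>
  have idem: "cov f (\<xi> n) * cov (\<xi> n) (\<xi> n) = cov f (\<xi> n)" for f n
  proof (cases "\<rho> n = 0")
    case False
    then have "\<rho> n > 0" using cov_nonneg by (simp add: \<rho>_def order_less_le)
    moreover have "cov (\<xi> n) (\<xi> n) = (1 / sqrt (\<rho> n)) * ((1 / sqrt (\<rho> n)) * \<rho> n)"
      unfolding \<xi>_def \<rho>_def by (simp only: cov_bilinear(5,6))
    ultimately have "cov (\<xi> n) (\<xi> n) = 1" by (simp add: field_simps)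
    then show ?thesis by simp
  next
    case True
    then have "cov (\<xi> n) f = 0" by (simp add: \<xi>_def cov_def)
    then show ?thesis by (simp add: cov_commute)
  qed
  have orth: "cov (f o\<^sub>L P n) (h o\<^sub>L P k) = cov (f o\<^sub>L P k) h" if "k \<le> n" for f h k n
    using that
  proof (induction n arbitrary: f h k rule: less_induct)
    case (less n')
    show ?case
    proof (cases n')
      case 0
      have "f o\<^sub>L P 0 = 0" for f :: "'a \<Rightarrow>\<^sub>L real"
        by (rule blinfun_eqI) (simp add: P_def)
      then show ?thesis using less.prems 0 by (simp add: cov_def)
    next
      case (Suc n)
      have IH: "cov (f o\<^sub>L P m) (h o\<^sub>L P k) = cov (f o\<^sub>L P k) h" if "k \<le> m" "m \<le> n" for f h k m
        using less.IH[of m k f h] that Suc by simp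
      \<comment> \<open>the projections are self-adjoint for the covariance form\<close>
      have sa: "cov (f o\<^sub>L P k) h = cov f (h o\<^sub>L P k)" if "k \<le> n" for f h :: "'a \<Rightarrow>\<^sub>L real" and k
        using IH[of k k f h] IH[of k k h f] that by (simp add: cov_commute)
    have \<xi>_orth: "cov (\<xi> n) (h o\<^sub>L P k) = 0" if "k \<le> n" for h k
      unfolding \<xi>_def cov_bilinear using IH[OF that order_refl, of "a n" h] sa[OF that, of "a n" h] by simp
    consider "k \<le> n" | "k = Suc n" using less.prems Suc by linarith
    then show ?thesis
    proof cases
      case 1
      then show ?thesis by (simp add: step cov_bilinear \<xi>_orth IH Suc)
    next
      case 2
      have "cov (f o\<^sub>L P (Suc n)) (h o\<^sub>L P (Suc n)) = cov (f o\<^sub>L P n) h + cov f (\<xi> n) * (cov h (\<xi> n) * cov (\<xi> n) (\<xi> n))"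
        using \<xi>_orth[of n f] cov_commute[of "f o\<^sub>L P n" "\<xi> n"] by (simp add: step cov_bilinear \<xi>_orth IH)
      also have "\<dots> = cov (f o\<^sub>L P (Suc n)) h"
        unfolding idem by (simp add: step cov_bilinear cov_commute[of "\<xi> n" h])
      finally show ?thesis using 2 Suc by simp
    qed
    qed
  qed
  show "k \<le> n \<Longrightarrow> cov (f o\<^sub>L P n) (h o\<^sub>L P k) = cov (f o\<^sub>L P k) h" by (rule orth)
  show "\<exists>\<xi>. (\<forall>f. cov (f o\<^sub>L P (Suc n)) f = cov (f o\<^sub>L P n) f + (cov f \<xi>)\<^sup>2)
        \<and> (cov (g n o\<^sub>L G) \<xi>)\<^sup>2 = cov (g n o\<^sub>L G) (g n o\<^sub>L G) - cov ((g n o\<^sub>L G) o\<^sub>L P n) (g n o\<^sub>L G)"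
  proof (intro exI conjI allI)
    fix f
    show "cov (f o\<^sub>L P (Suc n)) f = cov (f o\<^sub>L P n) f + (cov f (\<xi> n))\<^sup>2"
      by (simp add: step cov_bilinear power2_eq_square cov_commute[of "\<xi> n" f])
  next
    have sa: "cov (f o\<^sub>L P n) h = cov f (h o\<^sub>L P n)" for f h
      using orth[of n n f h] orth[of n n h f] by (simp add: cov_commute)
    have \<rho>: "\<rho> n = cov (a n) (a n) - cov (a n o\<^sub>L P n) (a n)"
      using orth[of n n "a n" "a n"] sa[of "a n" "a n"] by (simp add: \<rho>_def cov_bilinear)
    have "cov (a n) (\<xi> n) = (1 / sqrt (\<rho> n)) * \<rho> n"
      unfolding \<rho> using sa[of "a n" "a n"] by (simp add: \<xi>_def cov_bilinear \<rho>)
    moreover have "\<rho> n \<ge> 0" by (simp add: \<rho>_def cov_nonneg)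
    ultimately have "(cov (a n) (\<xi> n))\<^sup>2 = \<rho> n"
      by (cases "\<rho> n = 0") (simp_all add: power_mult_distrib power_divide power2_eq_square)
    then show "(cov (g n o\<^sub>L G) (\<xi> n))\<^sup>2 = cov (g n o\<^sub>L G) (g n o\<^sub>L G) - cov ((g n o\<^sub>L G) o\<^sub>L P n) (g n o\<^sub>L G)"
      using \<rho> by (simp add: a_def)
  qed
qed

text \<open>
  Consequences of being nested orthogonal projections: residual variances are differences of
  variances, and a difference of two of the operators is again a projection.
\<close>

lemma cov_regression_residual:
  fixes G :: "'a \<Rightarrow>\<^sub>L 'b::real_normed_vector" and g :: "nat \<Rightarrow> 'b \<Rightarrow>\<^sub>L real"
  defines "P \<equiv> \<lambda>n. regression G g n o\<^sub>L G"
  shows "cov (f - (f o\<^sub>L P n)) (f - (f o\<^sub>L P n)) = cov f f - cov (f o\<^sub>L P n) f"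
    and "cov (f o\<^sub>L P n) h = cov f (h o\<^sub>L P n)"
    and "k \<le> n \<Longrightarrow> cov (f o\<^sub>L (P n - P k)) (h o\<^sub>L (P n - P k)) = cov (f o\<^sub>L (P n - P k)) h"
proof -
  have orth: "cov (f o\<^sub>L P n) (h o\<^sub>L P k) = cov (f o\<^sub>L P k) h" if "k \<le> n" for k n f h
    unfolding P_def using that by (rule regression_orthogonality)
  have sa: "cov (f o\<^sub>L P n) h = cov f (h o\<^sub>L P n)" for f h n
    using orth[of n n f h] orth[of n n h f] by (simp add: cov_commute)
  then show "cov (f o\<^sub>L P n) h = cov f (h o\<^sub>L P n)" .
  show "cov (f - (f o\<^sub>L P n)) (f - (f o\<^sub>L P n)) = cov f f - cov (f o\<^sub>L P n) f"
    using orth[of n n f f] sa[of f n f] by (simp add: cov_bilinear)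
  assume k: "k \<le> n"
  have d: "f o\<^sub>L (P n - P k) = (f o\<^sub>L P n) - (f o\<^sub>L P k)" for f
    by (rule blinfun_eqI) (simp add: blinfun.diff_left blinfun.diff_right)
  show "cov (f o\<^sub>L (P n - P k)) (h o\<^sub>L (P n - P k)) = cov (f o\<^sub>L (P n - P k)) h"
    unfolding d cov_bilinear
    using orth[OF k, of f h] orth[OF k, of h f] orth[of n n f h] orth[of k k f h] sa[of f k h]
    by (simp add: cov_commute)
qed

lemma regression_variance_mono:
  fixes G :: "'a \<Rightarrow>\<^sub>L 'b::real_normed_vector"
  assumes "k \<le> n"
  shows "cov (f o\<^sub>L (regression G g k o\<^sub>L G)) f \<le> cov (f o\<^sub>L (regression G g n o\<^sub>L G)) f"
  using assms
proof (rule lift_Suc_mono_le[rotated])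
  fix n
  show "cov (f o\<^sub>L (regression G g n o\<^sub>L G)) f \<le> cov (f o\<^sub>L (regression G g (Suc n) o\<^sub>L G)) f"
    using regression_increment[where g=g and n=n and G=G] by (smt (verit) zero_le_power2)
qed

lemma regression_variance_le: "cov (f o\<^sub>L (regression G g n o\<^sub>L G)) f \<le> cov f f"
  using cov_regression_residual(1)[where f=f and G=G and g=g and n=n] cov_nonneg by (smt (verit))

text \<open>
  The variance of g j (G x) that is left unexplained vanishes at step j + 1 and cannot grow
  afterwards.
\<close>

lemma regression_reproduces:
  fixes G :: "'a \<Rightarrow>\<^sub>L 'b::real_normed_vector" and g :: "nat \<Rightarrow> 'b \<Rightarrow>\<^sub>L real"
  assumes "j < n"
  defines "r \<equiv> (g j o\<^sub>L G) - ((g j o\<^sub>L G) o\<^sub>L (regression G g n o\<^sub>L G))"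
  shows "cov r r = 0"
proof -
  have "cov (g j o\<^sub>L G) (g j o\<^sub>L G) = cov ((g j o\<^sub>L G) o\<^sub>L (regression G g (Suc j) o\<^sub>L G)) (g j o\<^sub>L G)"
    using regression_increment[where g=g and n=j and G=G] by (smt (verit))
  also have "\<dots> \<le> cov ((g j o\<^sub>L G) o\<^sub>L (regression G g n o\<^sub>L G)) (g j o\<^sub>L G)"
    using assms by (intro regression_variance_mono) simp
  finally show ?thesis
    using cov_nonneg[of r] unfolding r_def cov_regression_residual(1) by simp
qed

lemma regression_variance_convergent:
  "convergent (\<lambda>n. cov (f o\<^sub>L (regression G g n o\<^sub>L G)) f)"
proof -
  have mono: "incseq (\<lambda>n. cov (f o\<^sub>L (regression G g n o\<^sub>L G)) f)"
    by (intro incseq_SucI regression_variance_mono) simp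
  have "\<forall>n. cov (f o\<^sub>L (regression G g n o\<^sub>L G)) f \<le> cov f f"
    using regression_variance_le by blast
  then obtain L where "(\<lambda>n. cov (f o\<^sub>L (regression G g n o\<^sub>L G)) f) \<longlonglongrightarrow> L"
    by (rule incseq_convergent[OF mono])
  then show ?thesis by (rule convergentI)
qed

end

section \<open>Invariance and continuity of the covariance\<close>

lemma gaussian_withD:
  assumes "gaussian_with M m C"
  shows "prob_space M" "sets M = sets borel" "space M = UNIV" "covariance_form C"
    "(\<integral>x. cis (blinfun_apply f x) \<partial>M) = cis (blinfun_apply f m) * exp (- blinfun_apply f (C f) / 2)"
  using assms sets_eq_imp_space_eq[of M borel] by (auto simp: gaussian_with_def)

lemma gaussian_with_centred_char:
  assumes M: "gaussian_with M m C"
  shows "(\<integral>x. cis (blinfun_apply f (x - m)) \<partial>M) = exp (- blinfun_apply f (C f) / 2)"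
proof -
  have "cis (blinfun_apply f (x - m)) = cis (- blinfun_apply f m) * cis (blinfun_apply f x)" for x
    by (simp add: blinfun.diff_right cis_mult)
  then have "(\<integral>x. cis (blinfun_apply f (x - m)) \<partial>M) = cis (- blinfun_apply f m) * (\<integral>x. cis (blinfun_apply f x) \<partial>M)"
    by (simp only: integral_mult_right_zero)
  also have "\<dots> = (cis (- blinfun_apply f m) * cis (blinfun_apply f m)) * exp (- blinfun_apply f (C f) / 2)"
    by (simp only: gaussian_withD(5)[OF M] mult.assoc)
  finally show ?thesis by (simp add: cis_mult)
qed

text \<open>
  The characteristic functional of the centred measure depends on f only through f (C f), so
  preserving the covariance form is enough.
\<close>

lemma gaussian_with_invariant:
  assumes M: "gaussian_with M m C"
    and A: "\<And>f. blinfun_apply (f o\<^sub>L A) (C (f o\<^sub>L A)) = blinfun_apply f (C f)"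
  shows "distr M borel (\<lambda>x. m + blinfun_apply A (x - m)) = M"
proof (rule borel_measure_eqI_char_functional)
  interpret prob_space M using M by (rule gaussian_withD)
  have [measurable_cong]: "sets M = sets borel" using M by (rule gaussian_withD)
  show "finite_measure (distr M borel (\<lambda>x. m + blinfun_apply A (x - m)))" by (rule finite_measure_distr) simp
  show "finite_measure M" by unfold_locales
  fix f
  have "(\<integral>x. cis (blinfun_apply f x) \<partial>distr M borel (\<lambda>x. m + blinfun_apply A (x - m)))
      = (\<integral>x. cis (blinfun_apply f m) * cis (blinfun_apply (f o\<^sub>L A) (x - m)) \<partial>M)"
    by (simp add: integral_distr blinfun.add_right cis_mult)
  also have "\<dots> = cis (blinfun_apply f m) * (\<integral>x. cis (blinfun_apply (f o\<^sub>L A) (x - m)) \<partial>M)" by simp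
  also have "\<dots> = (\<integral>x. cis (blinfun_apply f x) \<partial>M)"
    unfolding gaussian_with_centred_char[OF M] A gaussian_withD(5)[OF M] ..
  finally show "(\<integral>x. cis (blinfun_apply f x) \<partial>distr M borel (\<lambda>x. m + blinfun_apply A (x - m)))
      = (\<integral>x. cis (blinfun_apply f x) \<partial>M)" .
qed (use gaussian_withD(2)[OF M] in simp_all)

text \<open>
  Continuity of the covariance form comes from the measure and not from the operator C. If
  variances were unbounded on the dual unit ball, rescaling to variance one would give
  functionals that tend to zero pointwise, although their characteristic functions at 1 all
  equal exp (-1/2).
\<close>

lemma gaussian_with_covariance_bounded:
  assumes M: "gaussian_with M m C"
  obtains K where "\<And>h. norm h \<le> 1 \<Longrightarrow> blinfun_apply h (C h) \<le> K"
proof -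
  interpret prob_space M using M by (rule gaussian_withD)
  interpret C: covariance_form C using M by (rule gaussian_withD)
  have [measurable_cong]: "sets M = sets borel" using M by (rule gaussian_withD)
  have "\<exists>K. \<forall>h. norm h \<le> 1 \<longrightarrow> blinfun_apply h (C h) \<le> K"
  proof (rule ccontr)
    assume "\<not> ?thesis"
    then have "\<forall>n::nat. \<exists>h. norm h \<le> 1 \<and> real n + 1 < blinfun_apply h (C h)" by (meson not_le)
    then obtain h where h: "\<And>n. norm (h n) \<le> 1" "\<And>n::nat. real n + 1 < C.cov (h n) (h n)"
      unfolding C.cov_def by metis
    \<comment> \<open>rescaled to variance one\<close>
    define g where "g n = (1 / sqrt (C.cov (h n) (h n))) *\<^sub>R h n" for n
    have pos: "0 < C.cov (h n) (h n)" for n using h(2)[of n] by linarith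
    have g1: "blinfun_apply (g n) (C (g n)) = 1" for n
    proof -
      have "C.cov (g n) (g n) = (1 / sqrt (C.cov (h n) (h n))) * ((1 / sqrt (C.cov (h n) (h n))) * C.cov (h n) (h n))"
        unfolding g_def by (simp only: C.cov_bilinear(5,6))
      also have "\<dots> = 1" using pos[of n] by (simp add: field_simps)
      finally show ?thesis by (simp add: C.cov_def)
    qed
    have lim: "(\<lambda>n. blinfun_apply (g n) y) \<longlonglongrightarrow> 0" for y
    proof (rule Lim_null_comparison)
      show "\<forall>\<^sub>F n in sequentially. norm (blinfun_apply (g n) y) \<le> inverse (sqrt (real n + 1)) * norm y"
      proof (intro always_eventually allI)
        fix n
        have "\<bar>blinfun_apply (h n) y\<bar> \<le> norm y"
          using norm_blinfun[of "h n" y] mult_right_mono[OF h(1)[of n], of "norm y"] by simp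
        moreover have "1 / sqrt (C.cov (h n) (h n)) \<le> inverse (sqrt (real n + 1))"
          using h(2)[of n] by (simp add: inverse_eq_divide frac_le)
        ultimately have "(1 / sqrt (C.cov (h n) (h n))) * \<bar>blinfun_apply (h n) y\<bar> \<le> inverse (sqrt (real n + 1)) * norm y"
          by (intro mult_mono) auto
        then show "norm (blinfun_apply (g n) y) \<le> inverse (sqrt (real n + 1)) * norm y"
          using pos[of n] by (simp add: g_def blinfun.scaleR_left abs_mult)
      qed
      show "(\<lambda>n. inverse (sqrt (real n + 1)) * norm y) \<longlonglongrightarrow> 0" by real_asymp
    qed
    have "(\<lambda>n. \<integral>x. cis (blinfun_apply (g n) (x - m)) \<partial>M) \<longlonglongrightarrow> (\<integral>x. cis 0 \<partial>M)"
    proof (rule integral_dominated_convergence[where w="\<lambda>_. 1"])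
      show "AE x in M. (\<lambda>n. cis (blinfun_apply (g n) (x - m))) \<longlonglongrightarrow> cis 0"
        by (intro always_eventually allI tendsto_intros lim)
    qed (auto simp del: cis_zero)
    then have "(\<lambda>n::nat. complex_of_real (exp (- (1/2)))) \<longlonglongrightarrow> 1"
      unfolding gaussian_with_centred_char[OF M] g1 by (simp add: prob_space[simplified])
    then have "complex_of_real (exp (- (1/2))) = 1" by (simp only: LIMSEQ_const_iff)
    then show False by (simp add: of_real_eq_1_iff)
  qed
  then show ?thesis using that by blast
qed

section \<open>Convergence of the regression in probability\<close>

text \<open>
  If D is an orthogonal projection for the covariance form, then 2 D - 1 is a reflection and
  leaves the measure invariant. Since D is the average of the identity and this reflection,
  D (x - m) lies, up to two small exceptional sets, in the set of midpoints of a compact set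
  that carries most of the mass. This set does not depend on D. The argument replaces
  integrability of the norm and maximal inequalities.
\<close>

lemma gaussian_with_projections_tight:
  assumes M: "gaussian_with M m C" and e: "e > 0"
  obtains K where "compact K"
    "\<And>D. (\<And>f. blinfun_apply (f o\<^sub>L D) (C (f o\<^sub>L D)) = blinfun_apply (f o\<^sub>L D) (C f))
        \<Longrightarrow> measure M {x. blinfun_apply D (x - m) \<notin> K} \<le> e"
proof -
  interpret prob_space M using M by (rule gaussian_withD)
  interpret C: covariance_form C using M by (rule gaussian_withD)
  have sM[measurable_cong]: "sets M = sets borel" using M by (rule gaussian_withD)
  have spM: "space M = UNIV" using M by (rule gaussian_withD)
  have "emeasure M UNIV = (SUP K\<in>{K. K \<subseteq> UNIV \<and> compact K}. emeasure M K)"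
    by (rule inner_regular) (use sM in auto)
  then have "1 - ennreal (e / 2) < (SUP K\<in>{K. compact K}. emeasure M K)"
    using emeasure_space_1 spM e by (auto intro!: ennreal_between)
  then obtain K0 where K0: "compact K0" "1 - ennreal (e / 2) < emeasure M K0"
    unfolding less_SUP_iff by auto
  have [measurable]: "K0 \<in> sets borel" using K0(1) by (simp add: borel_compact)
  have "1 - e / 2 \<le> measure M K0"
    using K0(2) e by (cases "e / 2 \<le> 1") (auto simp: emeasure_eq_measure ennreal_minus_if ennreal_less_iff simp flip: ennreal_1 intro: order_trans[OF _ measure_nonneg])
  then have out: "measure M {x. x \<notin> K0} \<le> e / 2"
    using prob_compl[of K0] spM sM by (simp add: Compl_eq_Diff_UNIV[symmetric] Compl_eq)
  \<comment> \<open>midpoints of pairs of points of K0, recentred\<close>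
  define K where "K = (\<lambda>(x, x'). (1/2) *\<^sub>R (x + x') - m) ` (K0 \<times> K0)"
  have "compact K"
    unfolding K_def case_prod_beta by (intro compact_continuous_image continuous_intros compact_Times K0)
  moreover have "measure M {x. blinfun_apply D (x - m) \<notin> K} \<le> e"
    if D: "\<And>f. blinfun_apply (f o\<^sub>L D) (C (f o\<^sub>L D)) = blinfun_apply (f o\<^sub>L D) (C f)" for D
  proof -
    \<comment> \<open>the reflection that belongs to D\<close>
    define A where "A = 2 *\<^sub>R D - id_blinfun"
    define \<phi> where "\<phi> x = m + blinfun_apply A (x - m)" for x
    have [measurable]: "\<phi> \<in> borel_measurable borel" unfolding \<phi>_def by measurable
    have fA: "f o\<^sub>L A = 2 *\<^sub>R (f o\<^sub>L D) - f" for f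
      by (rule blinfun_eqI) (simp add: A_def blinfun.diff_left blinfun.diff_right blinfun.scaleR_left blinfun.scaleR_right)
    have "C.cov (f o\<^sub>L A) (f o\<^sub>L A) = C.cov f f" for f
      unfolding fA C.cov_bilinear using D[of f, folded C.cov_def] C.cov_commute[of f "f o\<^sub>L D"] by simp
    then have inv: "distr M borel \<phi> = M"
      unfolding \<phi>_def by (intro gaussian_with_invariant[OF M]) (simp add: C.cov_def)
    have "measure M {x. \<phi> x \<notin> K0} = measure (distr M borel \<phi>) {x. x \<notin> K0}"
      by (subst measure_distr) (auto simp: spM vimage_def)
    then have out': "measure M {x. \<phi> x \<notin> K0} \<le> e / 2" using out inv by simp
    have "blinfun_apply D (x - m) = (1/2) *\<^sub>R (x + \<phi> x) - m" for x
      by (simp add: \<phi>_def A_def blinfun.diff_left blinfun.scaleR_left scaleR_add_right scaleR_diff_right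
          flip: scaleR_left_distrib)
    then have "{x. blinfun_apply D (x - m) \<notin> K} \<subseteq> {x. x \<notin> K0} \<union> {x. \<phi> x \<notin> K0}"
      by (auto simp: K_def)
    then have "measure M {x. blinfun_apply D (x - m) \<notin> K} \<le> measure M ({x. x \<notin> K0} \<union> {x. \<phi> x \<notin> K0})"
      by (intro finite_measure_mono) (simp_all add: sM)
    also have "\<dots> \<le> measure M {x. x \<notin> K0} + measure M {x. \<phi> x \<notin> K0}"
      by (intro measure_Un_le) (simp_all add: sM)
    finally show ?thesis using out out' by linarith
  qed
  ultimately show ?thesis using that by blast
qed

text \<open>
  Outside a ball some functional is nonzero at every point of K, and by compactness finitely
  many of them, with one common threshold, suffice.
\<close>

lemma compact_small_functionals_imp_small_norm:
  fixes h :: "nat \<Rightarrow> 'a::real_normed_vector \<Rightarrow>\<^sub>L real"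
  assumes K: "compact K" and d: "d > 0" and h: "\<And>x. x \<noteq> 0 \<Longrightarrow> \<exists>j. blinfun_apply (h j) x \<noteq> 0"
  obtains N :: nat where "\<And>x. x \<in> K \<Longrightarrow> (\<And>j. j < N \<Longrightarrow> \<bar>blinfun_apply (h j) x\<bar> \<le> 1 / real (Suc N)) \<Longrightarrow> norm x < d"
proof -
  \<comment> \<open>increasing in n: more functionals and a smaller threshold\<close>
  define U where "U n = (\<Union>j<n. {x. 1 / real (Suc n) < \<bar>blinfun_apply (h j) x\<bar>})" for n
  have "compact (K \<inter> {x. d \<le> norm x})"
    by (intro compact_Int_closed K closed_Collect_le continuous_intros)
  moreover have "open (U n)" for n
    unfolding U_def by (intro open_UN ballI open_Collect_less continuous_intros)
  moreover have "K \<inter> {x. d \<le> norm x} \<subseteq> (\<Union>n. U n)"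
  proof
    fix x assume "x \<in> K \<inter> {x. d \<le> norm x}"
    then have "x \<noteq> 0" using d by auto
    then obtain j where j: "0 < \<bar>blinfun_apply (h j) x\<bar>" using h by fastforce
    obtain i where i: "inverse (real (Suc i)) < \<bar>blinfun_apply (h j) x\<bar>" using reals_Archimedean[OF j] by auto
    have "1 / real (Suc (i + Suc j)) \<le> inverse (real (Suc i))" by (simp add: field_simps)
    then have "1 / real (Suc (i + Suc j)) < \<bar>blinfun_apply (h j) x\<bar>" using i by linarith
    then have "x \<in> U (i + Suc j)" unfolding U_def by (intro UN_I[of j]) simp_all
    then show "x \<in> (\<Union>n. U n)" by blast
  qed
  ultimately obtain F where F: "finite F" "K \<inter> {x. d \<le> norm x} \<subseteq> (\<Union>n\<in>F. U n)"
    by (rule compactE_image) simp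
  define N where "N = Max (insert 0 F)"
  have UN: "U n \<subseteq> U N" if "n \<in> F" for n
  proof
    fix x assume "x \<in> U n"
    then obtain j where j: "j < n" "1 / real (Suc n) < \<bar>blinfun_apply (h j) x\<bar>" by (auto simp: U_def)
    have "n \<le> N" using that F(1) by (simp add: N_def)
    then have "1 / real (Suc N) \<le> 1 / real (Suc n)" by (simp add: frac_le)
    then have "j < N" "1 / real (Suc N) < \<bar>blinfun_apply (h j) x\<bar>" using j \<open>n \<le> N\<close> by linarith+
    then show "x \<in> U N" by (auto simp: U_def)
  qed
  have "norm x < d" if "x \<in> K" "\<And>j. j < N \<Longrightarrow> \<bar>blinfun_apply (h j) x\<bar> \<le> 1 / real (Suc N)" for x
  proof (rule ccontr)
    assume "\<not> norm x < d"
    then have "x \<in> U N" using F(2) UN that(1) by fastforce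
    then show False using that(2) unfolding U_def by (auto simp: not_less dest!: leD)
  qed
  then show ?thesis using that by blast
qed

text \<open>
  Completeness for convergence in probability, by the Borel--Cantelli lemma along a
  subsequence with geometrically small increments.
\<close>

lemma (in prob_space) AE_convergent_subsequence:
  fixes X :: "nat \<Rightarrow> 'a \<Rightarrow> 'b::{banach, second_countable_topology}"
  assumes [measurable]: "\<And>n. X n \<in> borel_measurable M"
    and cauchy: "\<And>e. e > 0 \<Longrightarrow> \<exists>N. \<forall>k\<ge>N. \<forall>n\<ge>k. prob {x \<in> space M. e \<le> norm (X n x - X k x)} \<le> e"
  obtains r where "strict_mono r" "AE x in M. convergent (\<lambda>i. X (r i) x)"
proof -
  have "\<exists>N. \<forall>k\<ge>N. \<forall>n\<ge>k. prob {x \<in> space M. (1/2)^i \<le> norm (X n x - X k x)} \<le> (1/2)^i" for i :: nat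
    by (rule cauchy) simp
  then have "\<exists>N. \<forall>i. \<forall>k\<ge>N i. \<forall>n\<ge>k. prob {x \<in> space M. (1/2)^i \<le> norm (X n x - X k x)} \<le> (1/2)^i"
    by (intro choice allI)
  then obtain N where N: "\<And>i k n. N i \<le> k \<Longrightarrow> k \<le> n \<Longrightarrow> prob {x \<in> space M. (1/2)^i \<le> norm (X n x - X k x)} \<le> (1/2)^i"
    by blast
  \<comment> \<open>the sum dominates N i, and the summand i makes r strictly increasing\<close>
  define r where "r i = i + (\<Sum>j\<le>i. N j)" for i
  have r: "strict_mono r" by (intro strict_mono_Suc_iff[THEN iffD2]) (simp add: r_def)
  have "N i \<le> (\<Sum>j\<le>i. N j)" for i by (rule member_le_sum) auto
  then have rN: "N i \<le> r i" for i by (simp add: r_def trans_le_add2)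
  define A where "A i = {x \<in> space M. (1/2)^i \<le> norm (X (r (Suc i)) x - X (r i) x)}" for i
  have [measurable]: "A i \<in> events" for i unfolding A_def by measurable
  have "prob (A i) \<le> (1/2)^i" for i
    unfolding A_def using rN r by (intro N) (auto simp: strict_mono_def less_imp_le)
  then have "summable (\<lambda>i. prob (A i))"
    by (intro summable_comparison_test'[OF summable_geometric[of "1/2"]]) auto
  then have "AE x in M. eventually (\<lambda>i. x \<in> space M - A i) sequentially"
    by (intro borel_cantelli_AE1) (auto simp: emeasure_eq_measure)
  then have "AE x in M. convergent (\<lambda>i. X (r i) x)"
  proof (rule eventually_mono)
    fix x assume "eventually (\<lambda>i. x \<in> space M - A i) sequentially"
    then obtain i0 where i0: "\<And>i. i \<ge> i0 \<Longrightarrow> norm (X (r (Suc i)) x - X (r i) x) \<le> (1/2)^i"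
      unfolding A_def eventually_sequentially by fastforce
    have "summable (\<lambda>i. X (r (Suc i)) x - X (r i) x)"
      by (rule summable_comparison_test'[OF summable_geometric[of "1/2::real"] i0]) auto
    then have "convergent (\<lambda>n. X (r 0) x + (\<Sum>i<n. X (r (Suc i)) x - X (r i) x))"
      by (intro convergent_add convergent_const) (simp add: summable_iff_convergent)
    moreover have "(\<Sum>i<n. X (r (Suc i)) x - X (r i) x) = X (r n) x - X (r 0) x" for n
      by (rule sum_lessThan_telescope)
    ultimately show "convergent (\<lambda>i. X (r i) x)" by simp
  qed
  then show ?thesis using that r by blast
qed

text \<open>
  Increments of the regression stay in one compact set with high probability, and each
  functional of an increment is small in probability because its variance is an increment of
  a convergent sequence. On a compact set this makes the norm small.
\<close>

lemma regression_Cauchy_in_probability: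
  fixes G :: "'a::{banach, second_countable_topology} \<Rightarrow>\<^sub>L 'b::real_normed_vector" and g :: "nat \<Rightarrow> 'b \<Rightarrow>\<^sub>L real"
  assumes M: "gaussian_with M m C" and e: "e > 0"
  defines "P \<equiv> \<lambda>n. covariance_form.regression C G g n o\<^sub>L G"
  shows "\<exists>N. \<forall>k\<ge>N. \<forall>n\<ge>k. measure M {x. e \<le> norm (blinfun_apply (P n) (x - m) - blinfun_apply (P k) (x - m))} \<le> e"
proof -
  interpret prob_space M using M by (rule gaussian_withD)
  interpret C: covariance_form C using M by (rule gaussian_withD)
  have sM[measurable_cong]: "sets M = sets borel" using M by (rule gaussian_withD)
  obtain h :: "nat \<Rightarrow> 'a \<Rightarrow>\<^sub>L real" where h: "\<And>x. norm x = (SUP j. blinfun_apply (h j) x)"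
    using exists_countable_norming_family by metis
  have sep: "\<exists>j. blinfun_apply (h j) x \<noteq> 0" if "x \<noteq> 0" for x
  proof (rule ccontr)
    assume "\<nexists>j. blinfun_apply (h j) x \<noteq> 0"
    then have "norm x = 0" using h[of x] by simp
    then show False using that by simp
  qed
  have e2: "e / 2 > 0" using e by simp
  obtain K where K: "compact K"
    "\<And>D. (\<And>f. blinfun_apply (f o\<^sub>L D) (C (f o\<^sub>L D)) = blinfun_apply (f o\<^sub>L D) (C f))
        \<Longrightarrow> measure M {x. blinfun_apply D (x - m) \<notin> K} \<le> e / 2"
    using gaussian_with_projections_tight[OF M e2] by metis
  obtain N :: nat where N: "\<And>x. x \<in> K \<Longrightarrow> (\<And>j. j < N \<Longrightarrow> \<bar>blinfun_apply (h j) x\<bar> \<le> 1 / real (Suc N)) \<Longrightarrow> norm x < e"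
    using compact_small_functionals_imp_small_norm[OF K(1) e sep] by metis
  define \<eta> where "\<eta> = 1 / real (Suc N)"
  have \<eta>: "\<eta> > 0" by (simp add: \<eta>_def)
  define v where "v f n = C.cov (f o\<^sub>L P n) f" for f n
  \<comment> \<open>chosen so that N applications of Chebyshev's inequality at level \<eta> cost at most e /
    2 together\<close>
  define c where "c = e / 2 * \<eta>\<^sup>2 / real (Suc N)"
  have c: "c > 0" unfolding c_def using e \<eta> by (intro divide_pos_pos mult_pos_pos) auto
  have "\<exists>n0. \<forall>k\<ge>n0. \<forall>n\<ge>k. v f n - v f k < c" for f
  proof -
    have "Cauchy (v f)"
      unfolding v_def P_def by (intro convergent_Cauchy C.regression_variance_convergent)
    then obtain n0 where "\<And>k n. k \<ge> n0 \<Longrightarrow> n \<ge> n0 \<Longrightarrow> dist (v f k) (v f n) < c"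
      using c unfolding Cauchy_def by blast
    then have "dist (v f k) (v f n) < c" if "k \<ge> n0" "n \<ge> k" for k n
      using that order_trans by blast
    then have "v f n - v f k < c" if "k \<ge> n0" "n \<ge> k" for k n
      using that unfolding dist_real_def by (metis abs_less_iff minus_diff_eq)
    then show ?thesis by blast
  qed
  then obtain n0 where n0: "\<And>f k n. n0 f \<le> k \<Longrightarrow> k \<le> n \<Longrightarrow> v f n - v f k < c" by metis
  define N0 where "N0 = (\<Sum>j<N. n0 (h j))"
  have N0: "n0 (h j) \<le> N0" if "j < N" for j
    unfolding N0_def using that by (intro member_le_sum) auto
  show ?thesis
  proof (intro exI allI impI)
    fix k n assume k: "N0 \<le> k" and n: "k \<le> n"
    define D where "D = P n - P k"
    have D: "C.cov (f o\<^sub>L D) (f o\<^sub>L D) = C.cov (f o\<^sub>L D) f" for f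
      unfolding D_def P_def by (rule C.cov_regression_residual(3)[OF n])
    have covD: "C.cov (f o\<^sub>L D) (f o\<^sub>L D) = v f n - v f k" for f
    proof -
      have "f o\<^sub>L D = (f o\<^sub>L P n) - (f o\<^sub>L P k)"
        by (rule blinfun_eqI) (simp add: D_def blinfun.diff_left blinfun.diff_right)
      then show ?thesis unfolding D v_def by (simp only: C.cov_bilinear)
    qed
    define B where "B j = {x. \<eta> \<le> \<bar>blinfun_apply (h j) (blinfun_apply D (x - m))\<bar>}" for j
    have [measurable]: "B j \<in> sets borel" for j unfolding B_def by measurable
    have KB[measurable]: "{x. blinfun_apply D (x - m) \<notin> K} \<in> sets borel"
    proof -
      have [measurable]: "K \<in> sets borel" using K(1) by (rule borel_compact)
      show ?thesis by measurable
    qed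
    have B: "measure M (B j) \<le> e / 2 / real (Suc N)" if "j < N" for j
    proof -
      have "measure M (B j) \<le> blinfun_apply (h j o\<^sub>L D) (C (h j o\<^sub>L D)) / \<eta>\<^sup>2"
        using gaussian_with_Chebyshev[OF M \<eta>, of "h j o\<^sub>L D"] by (simp add: B_def)
      also have "blinfun_apply (h j o\<^sub>L D) (C (h j o\<^sub>L D)) = v (h j) n - v (h j) k"
        using covD by (simp add: C.cov_def)
      also have "(v (h j) n - v (h j) k) / \<eta>\<^sup>2 \<le> c / \<eta>\<^sup>2"
        using n0[of "h j" k n] N0[OF that] k n by (intro divide_right_mono) auto
      also have "\<dots> = e / 2 / real (Suc N)" using \<eta> by (simp add: c_def)
      finally show ?thesis .
    qed
    have "{x. e \<le> norm (blinfun_apply D (x - m))} \<subseteq> {x. blinfun_apply D (x - m) \<notin> K} \<union> (\<Union>j<N. B j)"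
    proof
      fix x assume x: "x \<in> {x. e \<le> norm (blinfun_apply D (x - m))}"
      show "x \<in> {x. blinfun_apply D (x - m) \<notin> K} \<union> (\<Union>j<N. B j)"
      proof (rule ccontr)
        assume "\<not> ?thesis"
        then have "blinfun_apply D (x - m) \<in> K" "\<And>j. j < N \<Longrightarrow> \<bar>blinfun_apply (h j) (blinfun_apply D (x - m))\<bar> \<le> \<eta>"
          by (auto simp: B_def not_le intro: less_imp_le)
        then have "norm (blinfun_apply D (x - m)) < e" unfolding \<eta>_def by (rule N)
        then show False using x by simp
      qed
    qed
    then have "measure M {x. e \<le> norm (blinfun_apply D (x - m))}
        \<le> measure M ({x. blinfun_apply D (x - m) \<notin> K} \<union> (\<Union>j<N. B j))"
      by (intro finite_measure_mono) (auto simp: sM intro!: sets.Un sets.finite_UN)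
    also have "\<dots> \<le> measure M {x. blinfun_apply D (x - m) \<notin> K} + measure M (\<Union>j<N. B j)"
      by (intro measure_Un_le) (auto simp: sM intro!: sets.finite_UN)
    also have "measure M (\<Union>j<N. B j) \<le> (\<Sum>j<N. measure M (B j))"
      by (intro measure_UNION_le) (auto simp: sM)
    also have "\<dots> \<le> (\<Sum>j<N. e / 2 / real (Suc N))" by (intro sum_mono B) auto
    also have "\<dots> \<le> e / 2" using e by (simp add: field_simps)
    also have "measure M {x. blinfun_apply D (x - m) \<notin> K} \<le> e / 2"
      by (rule K(2)) (use D in \<open>simp add: C.cov_def\<close>)
    finally show "measure M {x. e \<le> norm (blinfun_apply (P n) (x - m) - blinfun_apply (P k) (x - m))} \<le> e"
      by (simp add: D_def blinfun.diff_left)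
  qed
qed

text \<open>
  Needed to see that the residual has again a covariance operator with values in the space,
  so that the construction can be repeated for a second operator. The norm of an increment
  is attained by some functional; Cauchy--Schwarz bounds the resulting covariance by the
  bounded variance of that functional times the variance of an increment for f.
\<close>

lemma regression_apply_covariance_convergent:
  fixes G :: "'a::{banach, second_countable_topology} \<Rightarrow>\<^sub>L 'b::real_normed_vector" and g :: "nat \<Rightarrow> 'b \<Rightarrow>\<^sub>L real"
  assumes M: "gaussian_with M m C"
  defines "P \<equiv> \<lambda>n. covariance_form.regression C G g n o\<^sub>L G"
  shows "convergent (\<lambda>n. blinfun_apply (P n) (C f))"
proof -
  interpret C: covariance_form C using M by (rule gaussian_withD)
  obtain K0 where K0: "\<And>h. norm h \<le> 1 \<Longrightarrow> blinfun_apply h (C h) \<le> K0"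
    using gaussian_with_covariance_bounded[OF M] by blast
  \<comment> \<open>only to have a positive bound\<close>
  define K where "K = max K0 1"
  have K: "K > 0" "\<And>h. norm h \<le> 1 \<Longrightarrow> C.cov h h \<le> K"
    using K0 by (force simp: K_def C.cov_def)+
  define v where "v f n = C.cov (f o\<^sub>L P n) f" for f n
  have bound: "(norm (blinfun_apply (P n) (C f) - blinfun_apply (P k) (C f)))\<^sup>2 \<le> K * (v f n - v f k)" if n: "k \<le> n" for k n
  proof -
    define D where "D = P n - P k"
    have D: "C.cov (f o\<^sub>L D) (h o\<^sub>L D) = C.cov (f o\<^sub>L D) h" for f h
      unfolding D_def P_def by (rule C.cov_regression_residual(3)[OF n])
    have covD: "C.cov (f o\<^sub>L D) (f o\<^sub>L D) = v f n - v f k" for f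
    proof -
      have "f o\<^sub>L D = (f o\<^sub>L P n) - (f o\<^sub>L P k)"
        by (rule blinfun_eqI) (simp add: D_def blinfun.diff_left blinfun.diff_right)
      then show ?thesis unfolding D v_def by (simp only: C.cov_bilinear)
    qed
    obtain h :: "'a \<Rightarrow>\<^sub>L real" where h: "norm h \<le> 1" "blinfun_apply h (blinfun_apply D (C f)) = norm (blinfun_apply D (C f))"
      using exists_norming_functional by blast
    have "norm (blinfun_apply D (C f)) = C.cov (h o\<^sub>L D) f" using h(2) by (simp add: C.cov_def)
    also have "\<dots> = C.cov (h o\<^sub>L D) (f o\<^sub>L D)" by (simp only: D)
    finally have "(norm (blinfun_apply D (C f)))\<^sup>2 \<le> C.cov (h o\<^sub>L D) (h o\<^sub>L D) * C.cov (f o\<^sub>L D) (f o\<^sub>L D)"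
      using C.cov_Cauchy_Schwarz[of "h o\<^sub>L D" "f o\<^sub>L D"] by simp
    also have "\<dots> \<le> K * (v f n - v f k)"
    proof -
      have "v h k = C.cov (h o\<^sub>L P k) (h o\<^sub>L P k)"
        unfolding v_def P_def by (rule C.regression_orthogonality[OF order_refl, symmetric])
      then have "0 \<le> v h k" using C.cov_nonneg by simp
      moreover have "v h n \<le> C.cov h h" unfolding v_def P_def by (rule C.regression_variance_le)
      ultimately have "C.cov (h o\<^sub>L D) (h o\<^sub>L D) \<le> K" unfolding covD using K(2)[OF h(1)] by linarith
      then show ?thesis
        using C.cov_nonneg[of "f o\<^sub>L D"] unfolding covD[of f] by (rule mult_right_mono)
    qed
    finally show ?thesis by (simp add: D_def blinfun.diff_left)
  qed
  have "Cauchy (\<lambda>n. blinfun_apply (P n) (C f))"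
  proof (rule CauchyI')
    fix e :: real assume e: "e > 0"
    have "Cauchy (v f)"
      unfolding v_def P_def by (intro convergent_Cauchy C.regression_variance_convergent)
    then obtain n0 where n0: "\<And>k n. k \<ge> n0 \<Longrightarrow> n \<ge> n0 \<Longrightarrow> dist (v f k) (v f n) < e\<^sup>2 / K"
      using e K(1) unfolding Cauchy_def by (meson divide_pos_pos zero_less_power)
    show "\<exists>n0. \<forall>k\<ge>n0. \<forall>n>k. dist (blinfun_apply (P k) (C f)) (blinfun_apply (P n) (C f)) < e"
    proof (intro exI allI impI)
      fix k n assume kn: "n0 \<le> k" "k < n"
      then have "v f n - v f k < e\<^sup>2 / K" using n0[of k n] by (simp add: dist_real_def)
      then have "K * (v f n - v f k) < e\<^sup>2" using K(1) by (simp add: field_simps)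
      then have "(norm (blinfun_apply (P n) (C f) - blinfun_apply (P k) (C f)))\<^sup>2 < e\<^sup>2"
        using bound[of k n] kn by linarith
      then show "dist (blinfun_apply (P k) (C f)) (blinfun_apply (P n) (C f)) < e"
        using e by (simp add: dist_norm norm_minus_commute power_less_imp_less_base)
    qed
  qed
  then show ?thesis by (simp add: Cauchy_convergent_iff)
qed

section \<open>Prediction and independent residual\<close>

lemma char_distr_pair_add:
  fixes u :: "'a \<Rightarrow> 'b::{banach, second_countable_topology}"
  assumes "prob_space M" "prob_space N" and [measurable_cong]: "sets N = sets borel"
    and [measurable]: "u \<in> borel_measurable M"
  shows "(\<integral>x. cis (blinfun_apply f x) \<partial>distr (M \<Otimes>\<^sub>M N) borel (\<lambda>(x, z). u x + z))
    = (\<integral>x. cis (blinfun_apply f (u x)) \<partial>M) * (\<integral>z. cis (blinfun_apply f z) \<partial>N)"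
proof -
  interpret M: prob_space M by fact
  interpret N: prob_space N by fact
  interpret P: pair_prob_space M N ..
  have "integrable (M \<Otimes>\<^sub>M N) (\<lambda>p. cis (blinfun_apply f (u (fst p) + snd p)))"
    by (intro P.integrable_const_bound[of _ 1]) auto
  then have "(\<integral>x. (\<integral>z. cis (blinfun_apply f (u x + z)) \<partial>N) \<partial>M)
      = (\<integral>p. cis (blinfun_apply f (u (fst p) + snd p)) \<partial>(M \<Otimes>\<^sub>M N))"
    using P.integral_fst'[of "\<lambda>p. cis (blinfun_apply f (u (fst p) + snd p))"] by simp
  moreover have "(\<integral>x. cis (blinfun_apply f x) \<partial>distr (M \<Otimes>\<^sub>M N) borel (\<lambda>(x, z). u x + z))
      = (\<integral>p. cis (blinfun_apply f (u (fst p) + snd p)) \<partial>(M \<Otimes>\<^sub>M N))"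
    by (subst integral_distr) (auto simp: case_prod_beta)
  ultimately show ?thesis
    by (simp add: blinfun.add_right cis_mult[symmetric])
qed

text \<open>
  The map T is the measurable linear regression of x on G x, and \<kappa> is the law of the
  residual. The independence of prediction and residual is expressed by the last conclusion,
  an equality of laws, which needs only that the characteristic functionals multiply to that
  of M: the limiting variances of prediction and residual add up to the variance of M.
\<close>

theorem gaussian_regression:
  fixes M :: "'a::{banach, second_countable_topology} measure"
    and G :: "'a \<Rightarrow> 'b::{banach, second_countable_topology}"
  assumes M: "gaussian_with M m C" and "bounded_linear G"
  obtains T \<kappa> C' where "T \<in> borel_measurable borel" "AE x in M. G (T (G x)) = G x"
    "gaussian_with \<kappa> 0 C'" "AE z in \<kappa>. G z = 0"
    "M = distr (M \<Otimes>\<^sub>M \<kappa>) borel (\<lambda>(x, z). T (G x) + z)"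
proof -
  interpret prob_space M using M by (rule gaussian_withD)
  interpret C: covariance_form C using M by (rule gaussian_withD)
  have sM[measurable_cong]: "sets M = sets borel" using M by (rule gaussian_withD)
  have spM: "space M = UNIV" using M by (rule gaussian_withD)
  obtain G' :: "'a \<Rightarrow>\<^sub>L 'b" where G': "G = blinfun_apply G'"
    using bounded_linear_Blinfun_apply[OF \<open>bounded_linear G\<close>] by metis
  have [measurable]: "G \<in> borel_measurable borel" unfolding G' by measurable
  obtain g :: "nat \<Rightarrow> 'b \<Rightarrow>\<^sub>L real" where g: "\<And>y. norm y = (SUP j. blinfun_apply (g j) y)"
    using exists_countable_norming_family by metis
  define P where "P n = C.regression G' g n o\<^sub>L G'" for n
  have cauchy: "\<exists>N. \<forall>k\<ge>N. \<forall>n\<ge>k. prob {x \<in> space M. e \<le> norm (blinfun_apply (P n) (x - m) - blinfun_apply (P k) (x - m))} \<le> e"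
    if "e > 0" for e
    using regression_Cauchy_in_probability[OF M that, of G' g] by (simp add: spM P_def)
  have "(\<lambda>x. blinfun_apply (P n) (x - m)) \<in> borel_measurable M" for n by measurable
  then obtain r where r: "strict_mono r" "AE x in M. convergent (\<lambda>i. blinfun_apply (P (r i)) (x - m))"
    using cauchy by (rule AE_convergent_subsequence[where X="\<lambda>n x. blinfun_apply (P n) (x - m)"])
  define L where "L x = lim (\<lambda>i. blinfun_apply (P (r i)) (x - m))" for x
  have [measurable]: "L \<in> borel_measurable borel" unfolding L_def by measurable
  have L: "AE x in M. (\<lambda>i. blinfun_apply (P (r i)) (x - m)) \<longlonglongrightarrow> L x"
    using r(2) by (simp add: L_def convergent_LIMSEQ_iff)
  \<comment> \<open>where the sequence diverges, lim is an arbitrary value; this concerns a null set and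
    keeps T Borel\<close>
  define T where "T y = m + lim (\<lambda>i. blinfun_apply (C.regression G' g (r i)) (y - G m))" for y
  have T[measurable]: "T \<in> borel_measurable borel" unfolding T_def by measurable
  have TG: "T (G x) = m + L x" for x
    by (simp add: T_def L_def P_def G' blinfun.diff_right)
  define \<kappa> where "\<kappa> = distr M borel (\<lambda>x. x - T (G x))"
  have \<kappa>: "prob_space \<kappa>" "sets \<kappa> = sets borel"
    unfolding \<kappa>_def by (auto intro: prob_space_distr)

  have "AE x in M. blinfun_apply (g j) (G (L x)) = blinfun_apply (g j) (G (x - m))" for j
  proof -
    have "AE x in M. \<forall>n. j < n \<longrightarrow> blinfun_apply (g j) (G (x - m)) = blinfun_apply (g j) (G (blinfun_apply (P n) (x - m)))"
      unfolding AE_all_countable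
    proof (intro allI)
      fix n
      show "AE x in M. j < n \<longrightarrow> blinfun_apply (g j) (G (x - m)) = blinfun_apply (g j) (G (blinfun_apply (P n) (x - m)))"
      proof (cases "j < n")
        case True
        from C.regression_reproduces[OF this, of g G']
        have "AE x in M. blinfun_apply ((g j o\<^sub>L G') - ((g j o\<^sub>L G') o\<^sub>L P n)) (x - m) = 0"
          by (intro gaussian_with_AE_null[OF M]) (simp add: P_def C.cov_def)
        then show ?thesis by (simp add: G' blinfun.diff_left)
      qed simp
    qed
    with L show ?thesis
    proof eventually_elim
      case (elim x)
      have "(\<lambda>i. blinfun_apply (g j) (G (blinfun_apply (P (r i)) (x - m)))) \<longlonglongrightarrow> blinfun_apply (g j) (G (L x))"
        unfolding G' using elim(1) by (intro tendsto_intros)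
      moreover have "\<forall>\<^sub>F i in sequentially. blinfun_apply (g j) (G (blinfun_apply (P (r i)) (x - m))) = blinfun_apply (g j) (G (x - m))"
      proof (rule eventually_sequentiallyI[of "Suc j"])
        fix i assume "Suc j \<le> i"
        then have "j < r i" using seq_suble[OF r(1), of i] by simp
        then show "blinfun_apply (g j) (G (blinfun_apply (P (r i)) (x - m))) = blinfun_apply (g j) (G (x - m))"
          using elim(2) by simp
      qed
      ultimately have "(\<lambda>i::nat. blinfun_apply (g j) (G (x - m))) \<longlonglongrightarrow> blinfun_apply (g j) (G (L x))"
        by (rule Lim_transform_eventually)
      then show ?case by (simp add: LIMSEQ_const_iff)
    qed
  qed
  then have "AE x in M. \<forall>j. blinfun_apply (g j) (G (L x)) = blinfun_apply (g j) (G (x - m))"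
    by (simp add: AE_all_countable)
  then have GT: "AE x in M. G (T (G x)) = G x"
  proof eventually_elim
    case (elim x)
    then have "norm (G (L x) - G (x - m)) = 0" unfolding g by (simp add: blinfun.diff_right)
    then have "G (L x) = G x - G m" by (simp add: G' blinfun.diff_right)
    then show ?case unfolding TG by (simp add: G' blinfun.add_right)
  qed

  define v where "v f = lim (\<lambda>n. C.cov (f o\<^sub>L P n) f)" for f
  have "(\<lambda>n. C.cov (f o\<^sub>L P n) f) \<longlonglongrightarrow> v f" for f
    using C.regression_variance_convergent[of f G' g] by (simp add: v_def P_def convergent_LIMSEQ_iff)
  then have v: "(\<lambda>i. C.cov (f o\<^sub>L P (r i)) f) \<longlonglongrightarrow> v f" for f
    using LIMSEQ_subseq_LIMSEQ[OF _ r(1)] by (auto simp: comp_def)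
  have charL: "(\<integral>x. cis (blinfun_apply f (L x)) \<partial>M) = exp (- v f / 2)" for f
  proof (rule LIMSEQ_unique)
    show "(\<lambda>i. \<integral>x. cis (blinfun_apply f (blinfun_apply (P (r i)) (x - m))) \<partial>M) \<longlonglongrightarrow> (\<integral>x. cis (blinfun_apply f (L x)) \<partial>M)"
    proof (rule integral_dominated_convergence[where w="\<lambda>_. 1"])
      show "AE x in M. (\<lambda>i. cis (blinfun_apply f (blinfun_apply (P (r i)) (x - m)))) \<longlonglongrightarrow> cis (blinfun_apply f (L x))"
        using L by eventually_elim (intro tendsto_intros)
    qed auto
    have "(\<integral>x. cis (blinfun_apply f (blinfun_apply (P n) (x - m))) \<partial>M) = exp (- C.cov (f o\<^sub>L P n) f / 2)" for n
      using gaussian_with_centred_char[OF M, of "f o\<^sub>L P n"] C.regression_orthogonality[of n n f G' g f]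
      by (simp add: P_def C.cov_def)
    then show "(\<lambda>i. \<integral>x. cis (blinfun_apply f (blinfun_apply (P (r i)) (x - m))) \<partial>M) \<longlonglongrightarrow> exp (- v f / 2)"
      by (simp only:) (intro tendsto_intros v; simp)
  qed
  have charR: "(\<integral>x. cis (blinfun_apply f (x - m - L x)) \<partial>M) = exp (- (blinfun_apply f (C f) - v f) / 2)" for f
  proof (rule LIMSEQ_unique)
    show "(\<lambda>i. \<integral>x. cis (blinfun_apply f (x - m - blinfun_apply (P (r i)) (x - m))) \<partial>M) \<longlonglongrightarrow> (\<integral>x. cis (blinfun_apply f (x - m - L x)) \<partial>M)"
    proof (rule integral_dominated_convergence[where w="\<lambda>_. 1"])
      show "AE x in M. (\<lambda>i. cis (blinfun_apply f (x - m - blinfun_apply (P (r i)) (x - m)))) \<longlonglongrightarrow> cis (blinfun_apply f (x - m - L x))"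
        using L by eventually_elim (intro tendsto_intros)
    qed auto
    have "(\<integral>x. cis (blinfun_apply f (x - m - blinfun_apply (P n) (x - m))) \<partial>M) = exp (- (blinfun_apply f (C f) - C.cov (f o\<^sub>L P n) f) / 2)" for n
    proof -
      have "blinfun_apply f (x - m - blinfun_apply (P n) (x - m)) = blinfun_apply (f - (f o\<^sub>L P n)) (x - m)" for x
        by (simp add: blinfun.diff_left blinfun.diff_right)
      moreover have "blinfun_apply (f - (f o\<^sub>L P n)) (C (f - (f o\<^sub>L P n))) = blinfun_apply f (C f) - C.cov (f o\<^sub>L P n) f"
        using C.cov_regression_residual(1)[of f G' g n] unfolding P_def[symmetric] by (simp only: C.cov_def)
      ultimately show ?thesis by (simp only: gaussian_with_centred_char[OF M])
    qed
    then show "(\<lambda>i. \<integral>x. cis (blinfun_apply f (x - m - blinfun_apply (P (r i)) (x - m))) \<partial>M) \<longlonglongrightarrow> exp (- (blinfun_apply f (C f) - v f) / 2)"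
      by (simp only:) (intro tendsto_intros v; simp)
  qed
  have char\<kappa>: "(\<integral>z. cis (blinfun_apply f z) \<partial>\<kappa>) = exp (- (blinfun_apply f (C f) - v f) / 2)" for f
    unfolding charR[symmetric] \<kappa>_def by (simp add: integral_distr TG diff_diff_eq)

  define C' where "C' f = C f - lim (\<lambda>n. blinfun_apply (P n) (C f))" for f
  have C': "(\<lambda>n. C.cov h f - C.cov (h o\<^sub>L P n) f) \<longlonglongrightarrow> blinfun_apply h (C' f)" for h f
  proof -
    have "(\<lambda>n. blinfun_apply (P n) (C f)) \<longlonglongrightarrow> lim (\<lambda>n. blinfun_apply (P n) (C f))"
      using regression_apply_covariance_convergent[OF M, of G' g f] by (simp add: P_def convergent_LIMSEQ_iff)
    then have "(\<lambda>n. blinfun_apply h (C f - blinfun_apply (P n) (C f))) \<longlonglongrightarrow> blinfun_apply h (C' f)"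
      unfolding C'_def by (intro tendsto_intros)
    then show ?thesis by (simp add: C.cov_def blinfun.diff_right)
  qed
  have "covariance_form C'"
  proof
    fix f h
    have "C.cov h f - C.cov (h o\<^sub>L P n) f = C.cov f h - C.cov (f o\<^sub>L P n) h" for n
      using C.cov_regression_residual(2)[of h G' g n f] C.cov_commute by (simp add: P_def)
    then show "blinfun_apply f (C' h) = blinfun_apply h (C' f)"
      using LIMSEQ_unique[OF C'[of h f]] C'[of f h] by simp
    have "0 \<le> C.cov f f - C.cov (f o\<^sub>L P n) f" for n
      using C.regression_variance_le[of f G' g n] by (simp add: P_def)
    then show "0 \<le> blinfun_apply f (C' f)" by (intro LIMSEQ_le_const[OF C']) blast
  qed
  moreover have "blinfun_apply f (C' f) = blinfun_apply f (C f) - v f" for f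
  proof (rule LIMSEQ_unique)
    show "(\<lambda>i. C.cov f f - C.cov (f o\<^sub>L P (r i)) f) \<longlonglongrightarrow> blinfun_apply f (C' f)"
      using LIMSEQ_subseq_LIMSEQ[OF C'[of f f] r(1)] by (simp add: comp_def)
    show "(\<lambda>i. C.cov f f - C.cov (f o\<^sub>L P (r i)) f) \<longlonglongrightarrow> blinfun_apply f (C f) - v f"
      unfolding C.cov_def[of f f] by (intro tendsto_intros v)
  qed
  ultimately have "gaussian_with \<kappa> 0 C'"
    unfolding gaussian_with_def using \<kappa> char\<kappa> by simp

  moreover have "M = distr (M \<Otimes>\<^sub>M \<kappa>) borel (\<lambda>(x, z). T (G x) + z)"
  proof (rule borel_measure_eqI_char_functional)
    note [measurable_cong] = \<kappa>(2)
    interpret K: prob_space \<kappa> by fact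
    interpret P: pair_prob_space M \<kappa> ..
    show "finite_measure M" by unfold_locales
    show "finite_measure (distr (M \<Otimes>\<^sub>M \<kappa>) borel (\<lambda>(x, z). T (G x) + z))"
      by (rule P.finite_measure_distr) measurable
    fix f
    have "(\<integral>x. cis (blinfun_apply f (T (G x))) \<partial>M) = cis (blinfun_apply f m) * exp (- v f / 2)"
      unfolding TG charL[symmetric] by (simp add: blinfun.add_right cis_mult[symmetric])
    then have "(\<integral>x. cis (blinfun_apply f x) \<partial>distr (M \<Otimes>\<^sub>M \<kappa>) borel (\<lambda>(x, z). T (G x) + z))
        = cis (blinfun_apply f m) * (exp (- v f / 2) * exp (- (blinfun_apply f (C f) - v f) / 2))"
      by (subst char_distr_pair_add) (simp_all add: char\<kappa> \<kappa> prob_space_axioms)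
    also have "exp (- v f / 2) * exp (- (blinfun_apply f (C f) - v f) / 2) = exp (- blinfun_apply f (C f) / 2)"
      by (simp add: exp_add[symmetric] field_simps)
    finally show "(\<integral>x. cis (blinfun_apply f x) \<partial>M)
        = (\<integral>x. cis (blinfun_apply f x) \<partial>distr (M \<Otimes>\<^sub>M \<kappa>) borel (\<lambda>(x, z). T (G x) + z))"
      using gaussian_withD(5)[OF M, of f] by simp
  qed (simp_all add: sM)
  moreover have "AE z in \<kappa>. G z = 0"
  proof -
    have "AE x in M. G (x - T (G x)) = 0"
      using GT by eventually_elim (simp add: G' blinfun.diff_right)
    then show ?thesis unfolding \<kappa>_def by (subst AE_distr_iff) simp_all
  qed
  ultimately show ?thesis using that[OF T GT] by blast
qed

section \<open>Disintegrations and their iteration\<close>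

lemma disintegration_kernel:
  assumes "disintegration M N G D"
  shows "D \<in> measurable N (prob_algebra M)"
proof (rule measurable_prob_algebraI)
  show "prob_space (D y)" if "y \<in> space N" for y
    using assms that by (auto simp: disintegration_def)
  show "D \<in> measurable N (subprob_algebra M)"
    using assms by (intro measurable_subprob_algebra)
      (auto simp: disintegration_def intro: prob_space_imp_subprob_space)
qed

text \<open>
  In the language of the Giry monad a disintegration is a kernel that binds the law of G to
  M. This gives access to the integration and null-set rules for bind.
\<close>

lemma disintegration_bind:
  assumes D: "disintegration M N G D"
  shows "M = distr M N G \<bind> D"
proof (rule measure_eqI)
  interpret prob_space M using D by (simp add: disintegration_def)
  have G: "G \<in> measurable M N" using D by (simp add: disintegration_def)
  then have ne: "space (distr M N G) \<noteq> {}" using not_empty by (auto dest: measurable_space)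
  have K: "D \<in> measurable (distr M N G) (subprob_algebra M)"
    using disintegration_kernel[OF D] by (simp add: measurable_prob_algebraD)
  show "sets M = sets (distr M N G \<bind> D)" using sets_bind[OF sets_kernel[OF K] ne] by simp
  show "emeasure M A = emeasure (distr M N G \<bind> D) A" if "A \<in> sets M" for A
    using emeasure_bind[OF ne K that] D that by (simp add: disintegration_def)
qed

lemma disintegration_AE_fibre:
  assumes D: "disintegration M N G D"
  shows "AE y in distr M N G. AE x in D y. G x = y"
proof -
  have M: "prob_space M" and G: "G \<in> measurable M N" using D by (auto simp: disintegration_def)
  interpret Y: prob_space "distr M N G" by (rule prob_space.prob_space_distr[OF M G])
  obtain S where S: "S \<in> sets N" "emeasure (distr M N G) S = 1"
    "\<And>y. y \<in> S \<Longrightarrow> emeasure (D y) (G -` {y} \<inter> space M) = 1"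
    using D unfolding disintegration_def by blast
  have "AE y in distr M N G. y \<in> S"
    using S(1,2) by (subst Y.AE_in_set_eq_1) (simp_all add: measure_def)
  then show ?thesis
  proof eventually_elim
    case (elim y)
    then have y: "y \<in> space N" using S(1) sets.sets_into_space by blast
    then have "prob_space (D y)" using D by (simp add: disintegration_def)
    then interpret Dy: prob_space "D y" .
    have "G -` {y} \<inter> space M \<in> sets (D y)"
      using S(3)[OF elim] emeasure_notin_sets by fastforce
    then have "AE x in D y. x \<in> G -` {y} \<inter> space M"
      using S(3)[OF elim] by (subst Dy.AE_in_set_eq_1) (simp_all add: measure_def)
    then show ?case by eventually_elim simp
  qed
qed

text \<open>
  Holding almost surely means having probability one, and under a kernel the probability of
  a section depends measurably on the parameter. This yields the measurable set of good
  parameters in a disintegration.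
\<close>

lemma pred_AE_kernel:
  assumes K: "K \<in> measurable N (prob_algebra M)"
    and P[measurable]: "Measurable.pred (N \<Otimes>\<^sub>M M) (\<lambda>p. P (fst p) (snd p))"
  shows "Measurable.pred N (\<lambda>y. AE x in K y. P y x)"
proof -
  have Ky: "prob_space (K y)" "sets (K y) = sets M" if "y \<in> space N" for y
    using measurable_space[OF K that] by (auto simp: space_prob_algebra)
  have "{p \<in> space (N \<Otimes>\<^sub>M M). P (fst p) (snd p)} \<in> sets (N \<Otimes>\<^sub>M M)" by measurable
  then have "(SIGMA y:space N. {x \<in> space M. P y x}) \<in> sets (N \<Otimes>\<^sub>M M)"
    by (rule back_subst[where P="\<lambda>A. A \<in> sets (N \<Otimes>\<^sub>M M)"]) (auto simp: space_pair_measure)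
  then have [measurable]: "(\<lambda>y. emeasure (K y) {x \<in> space M. P y x}) \<in> borel_measurable N"
    using measurable_prob_algebraD[OF K] by (rule emeasure_measurable_subprob_algebra2)
  have "(AE x in K y. P y x) \<longleftrightarrow> emeasure (K y) {x \<in> space M. P y x} = 1" if y: "y \<in> space N" for y
  proof -
    interpret prob_space "K y" by (rule Ky(1)[OF y])
    have [measurable_cong]: "sets (K y) = sets M" by (rule Ky(2)[OF y])
    have "Measurable.pred M (P y)"
      using measurable_compose[OF measurable_Pair1'[OF y] P] by simp
    then have "{x \<in> space M. P y x} \<in> sets (K y)"
      using Ky(2)[OF y] by (simp add: pred_def)
    from AE_in_set_eq_1[OF this] show ?thesis
      using sets_eq_imp_space_eq[OF Ky(2)[OF y]] AE_space[of "K y"] by (simp add: emeasure_eq_measure)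
  qed
  moreover have "Measurable.pred N (\<lambda>y. emeasure (K y) {x \<in> space M. P y x} = 1)" by measurable
  ultimately show ?thesis by (simp cong: measurable_cong)
qed

text \<open>
  A criterion in which the exceptional set has disappeared: concentration on the fibres is
  only checked at the points G x.
\<close>

lemma disintegrationI_AE_fibre:
  fixes G :: "'a \<Rightarrow> 'b::{second_countable_topology, t2_space}"
  assumes "prob_space M" and G[measurable]: "G \<in> borel_measurable M"
    and D[measurable]: "D \<in> measurable borel (prob_algebra M)"
    and fibre: "AE x in M. AE x' in D (G x). G x' = G x"
    and total: "\<And>A. A \<in> sets M \<Longrightarrow> emeasure M A = (\<integral>\<^sup>+x. emeasure (D (G x)) A \<partial>M)"
  shows "disintegration M borel G D"
proof -
  interpret prob_space M by fact
  interpret Y: prob_space "distr M borel G" by (rule prob_space_distr) simp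
  have Dsub[measurable]: "D \<in> measurable borel (subprob_algebra M)"
    using D by (rule measurable_prob_algebraD)
  have Dy: "prob_space (D y)" "sets (D y) = sets M" for y
    using measurable_space[OF D, of y] by (auto simp: space_prob_algebra)
  define S where "S = {y. AE x in D y. G x = y}"
  have "Measurable.pred borel (\<lambda>y. AE x in D y. G x = y)"
    by (rule pred_AE_kernel[OF D]) measurable
  then have S[measurable]: "S \<in> sets borel" by (simp add: S_def pred_def)
  have "AE x in M. G x \<in> S" using fibre by (simp add: S_def)
  then have "emeasure (distr M borel G) S = 1"
    by (subst Y.emeasure_eq_1_AE) (simp_all add: AE_distr_iff)
  moreover have "{y} \<in> sets borel \<and> emeasure (D y) (G -` {y} \<inter> space M) = 1" if "y \<in> S" for y
  proof -
    interpret Dy: prob_space "D y" by (rule Dy)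
    have "G -` {y} \<inter> space M \<in> sets M" by measurable
    then have "emeasure (D y) (G -` {y} \<inter> space M) = 1"
      using that sets_eq_imp_space_eq[OF Dy(2)[of y]] Dy(2)[of y]
      by (subst Dy.emeasure_eq_1_AE) (auto simp: S_def)
    then show ?thesis by simp
  qed
  moreover have "(\<lambda>y. emeasure (D y) A) \<in> borel_measurable borel" if [measurable]: "A \<in> sets M" for A
    by measurable
  ultimately show ?thesis
    unfolding disintegration_def using Dy total G prob_space_axioms S
    by (auto simp: nn_integral_distr)
qed

text \<open>
  Conditioning first on G1 and then on G2 is conditioning on both; this is a fact about
  kernels. Averaging the second family over the first returns M, because on the fibre over
  y1 one may replace y1 by G1 x; and D2 y1 y2 inherits concentration on the fibre of G1 from
  D1 y1. Joint measurability is a genuine hypothesis, since the second disintegration may be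
  chosen separately for each y1.
\<close>

theorem iterated_disintegration:
  fixes G1 :: "'a \<Rightarrow> 'b::{second_countable_topology, t2_space}"
    and G2 :: "'a \<Rightarrow> 'c::{second_countable_topology, t2_space}"
  assumes D1: "disintegration M borel G1 D1"
    and D2: "\<And>y1. disintegration (D1 y1) borel G2 (D2 y1)"
    and joint: "(\<lambda>(y1, y2). D2 y1 y2) \<in> measurable borel (prob_algebra M)"
  shows "disintegration M borel (\<lambda>x. (G1 x, G2 x)) (\<lambda>(y1, y2). D2 y1 y2)"
proof (rule disintegrationI_AE_fibre)
  show "prob_space M" using D1 by (simp add: disintegration_def)
  have D1y: "prob_space (D1 y)" "sets (D1 y) = sets M" for y
    using D1 by (auto simp: disintegration_def)
  have G1[measurable]: "G1 \<in> borel_measurable M" using D1 by (simp add: disintegration_def)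
  have "G2 \<in> borel_measurable (D1 undefined)" using D2[of undefined] by (simp add: disintegration_def)
  then have G2[measurable]: "G2 \<in> borel_measurable M" by (simp only: measurable_cong_sets[OF D1y(2) refl])
  show "(\<lambda>x. (G1 x, G2 x)) \<in> borel_measurable M" by measurable
  have joint': "(\<lambda>p. D2 (fst p) (snd p)) \<in> measurable (borel \<Otimes>\<^sub>M borel) (subprob_algebra M)"
    using measurable_prob_algebraD[OF joint] by (simp add: case_prod_beta' borel_prod)
  have D2y: "sets (D2 y1 y2) = sets M" for y1 y2
    using D2[of y1] D1y(2) by (auto simp: disintegration_def)
  have K1: "D1 \<in> measurable (distr M borel G1) (subprob_algebra M)"
    using disintegration_kernel[OF D1] by (simp add: measurable_prob_algebraD)
  have K2: "D2 y1 \<in> measurable (distr (D1 y1) borel G2) (subprob_algebra M)" for y1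
    using measurable_prob_algebraD[OF disintegration_kernel[OF D2[of y1]]]
    unfolding subprob_algebra_cong[OF D1y(2)] by simp
  note b1 = disintegration_bind[OF D1] and b2 = disintegration_bind[OF D2]
  have [measurable]: "Measurable.pred M (\<lambda>x. G1 x = y)" for y by measurable

  have "Measurable.pred (borel \<Otimes>\<^sub>M borel) (\<lambda>p. AE x' in D2 (fst p) (snd p). (G1 x', G2 x') = p)"
    unfolding prod_eq_iff fst_conv snd_conv
    by (rule pred_AE_kernel, use joint in \<open>simp add: case_prod_beta' borel_prod\<close>) measurable
  from measurable_compose[of "\<lambda>x. (G1 x, G2 x)" M, OF _ this]
  have Q: "Measurable.pred M (\<lambda>x. AE x' in D2 (G1 x) (G2 x). (G1 x', G2 x') = (G1 x, G2 x))"
    unfolding fst_conv snd_conv by measurable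
  have "AE y1 in distr M borel G1. AE x in D1 y1. AE x' in D2 (G1 x) (G2 x). (G1 x', G2 x') = (G1 x, G2 x)"
    using disintegration_AE_fibre[OF D1]
  proof eventually_elim
    case (elim y1)
    have G2y: "G2 \<in> measurable (D1 y1) borel" using D2[of y1] by (simp add: disintegration_def)
    have "AE x in D1 y1. AE x' in D2 y1 (G2 x). G2 x' = G2 x"
      by (rule AE_distrD[OF G2y disintegration_AE_fibre[OF D2]])
    moreover have "AE x in distr (D1 y1) borel G2 \<bind> D2 y1. G1 x = y1"
      using elim by (simp only: b2[of y1, symmetric])
    then have "AE y2 in distr (D1 y1) borel G2. AE x' in D2 y1 y2. G1 x' = y1"
      by (subst (asm) AE_bind[OF K2]) simp_all
    then have "AE x in D1 y1. AE x' in D2 y1 (G2 x). G1 x' = y1"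
      by (rule AE_distrD[OF G2y])
    ultimately show ?case
      using elim by eventually_elim (auto elim: eventually_elim2)
  qed
  then have "AE x in distr M borel G1 \<bind> D1. AE x' in D2 (G1 x) (G2 x). (G1 x', G2 x') = (G1 x, G2 x)"
    by (simp only: AE_bind[OF K1 Q])
  then show "AE x in M. AE x' in (case (G1 x, G2 x) of (y1, y2) \<Rightarrow> D2 y1 y2). (G1 x', G2 x') = (G1 x, G2 x)"
    by (simp only: b1[symmetric] prod.case)
  show "emeasure M A = (\<integral>\<^sup>+x. emeasure (case (G1 x, G2 x) of (y1, y2) \<Rightarrow> D2 y1 y2) A \<partial>M)" if A: "A \<in> sets M" for A
  proof -
    have F: "(\<lambda>p. emeasure (D2 (fst p) (snd p)) A) \<in> borel_measurable (borel \<Otimes>\<^sub>M borel)"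
      using joint' A by (rule measurable_compose[OF _ measurable_emeasure_subprob_algebra])
    have Fx: "(\<lambda>x. emeasure (D2 (G1 x) (G2 x)) A) \<in> borel_measurable M"
      using measurable_compose[OF _ F, of "\<lambda>x. (G1 x, G2 x)" M] by simp
    have "emeasure M A = (\<integral>\<^sup>+y1. emeasure (D1 y1) A \<partial>distr M borel G1)"
      using D1 A by (simp add: disintegration_def)
    also have "\<dots> = (\<integral>\<^sup>+y1. (\<integral>\<^sup>+x. emeasure (D2 (G1 x) (G2 x)) A \<partial>D1 y1) \<partial>distr M borel G1)"
    proof (rule nn_integral_cong_AE)
      show "AE y1 in distr M borel G1. emeasure (D1 y1) A = (\<integral>\<^sup>+x. emeasure (D2 (G1 x) (G2 x)) A \<partial>D1 y1)"
        using disintegration_AE_fibre[OF D1]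
      proof eventually_elim
        case (elim y1)
        have m: "(\<lambda>y2. emeasure (D2 y1 y2) A) \<in> borel_measurable borel" "G2 \<in> borel_measurable (D1 y1)"
          using D2[of y1] A D1y(2)[of y1] by (auto simp: disintegration_def)
        have "emeasure (D1 y1) A = (\<integral>\<^sup>+x. emeasure (D2 y1 (G2 x)) A \<partial>D1 y1)"
          using D2[of y1] A D1y(2)[of y1] m by (simp add: disintegration_def nn_integral_distr)
        also have "\<dots> = (\<integral>\<^sup>+x. emeasure (D2 (G1 x) (G2 x)) A \<partial>D1 y1)"
          using elim by (intro nn_integral_cong_AE) auto
        finally show ?case .
      qed
    qed
    also have "\<dots> = (\<integral>\<^sup>+x. emeasure (D2 (G1 x) (G2 x)) A \<partial>M)"
      using nn_integral_bind[OF Fx K1] b1 by simp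
    finally show ?thesis by simp
  qed
qed (rule joint)

section \<open>Iterated conditioning of Gaussian measures\<close>

lemma translate_kernel_measurable:
  fixes a :: "'b \<Rightarrow> 'a::{real_normed_vector, second_countable_topology}"
  assumes "prob_space \<kappa>" and [measurable_cong]: "sets \<kappa> = sets borel" and [measurable]: "a \<in> borel_measurable N"
  shows "(\<lambda>y. distr \<kappa> borel (\<lambda>z. a y + z)) \<in> measurable N (prob_algebra borel)"
proof (rule measurable_prob_algebraI)
  interpret prob_space \<kappa> by fact
  show "prob_space (distr \<kappa> borel (\<lambda>z. a y + z))" for y
    by (rule prob_space_distr) simp
  show "(\<lambda>y. distr \<kappa> borel (\<lambda>z. a y + z)) \<in> measurable N (subprob_algebra borel)"
    by (rule measurable_distr2[where M=\<kappa>]) (simp_all add: prob_space_axioms prob_space_imp_subprob_space space_subprob_algebra)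
qed

text \<open>
  If M is the law of S (G x) + z with an independent z, and such a sum lies in the fibre
  over G x, then conditioning on G x = y fixes the first summand only.
\<close>

lemma disintegration_translates:
  fixes M :: "'a::{real_normed_vector, second_countable_topology} measure"
    and G :: "'a \<Rightarrow> 'b::{second_countable_topology, t2_space}"
  assumes M: "prob_space M" "sets M = sets borel" and \<kappa>: "prob_space \<kappa>" "sets \<kappa> = sets borel"
    and G[measurable]: "G \<in> borel_measurable borel" and S[measurable]: "S \<in> borel_measurable borel"
    and law: "\<And>A. A \<in> sets borel \<Longrightarrow> emeasure M A = (\<integral>\<^sup>+x. \<integral>\<^sup>+z. indicator A (S (G x) + z) \<partial>\<kappa> \<partial>M)"
    and fibre: "AE x in M. AE z in \<kappa>. G (S (G x) + z) = G x"
  shows "disintegration M borel G (\<lambda>y. distr \<kappa> borel (\<lambda>z. S y + z))"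
proof (rule disintegrationI_AE_fibre)
  interpret K: prob_space \<kappa> by (rule \<kappa>)
  note [measurable_cong] = M(2) \<kappa>(2)
  have "prob_algebra M = prob_algebra borel" using subprob_algebra_cong[OF M(2)] by (simp add: prob_algebra_def)
  then show "(\<lambda>y. distr \<kappa> borel (\<lambda>z. S y + z)) \<in> measurable borel (prob_algebra M)"
    using translate_kernel_measurable[OF \<kappa> S] by simp
  show "AE x in M. AE x' in distr \<kappa> borel (\<lambda>z. S (G x) + z). G x' = G x"
    using fibre
  proof eventually_elim
    case (elim x)
    then show ?case by (subst AE_distr_iff) auto
  qed
  show "emeasure M A = (\<integral>\<^sup>+x. emeasure (distr \<kappa> borel (\<lambda>z. S (G x) + z)) A \<partial>M)" if "A \<in> sets M" for A
  proof -
    have [measurable]: "A \<in> sets borel" using that M(2) by simp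
    have "emeasure (distr \<kappa> borel (\<lambda>z. a + z)) A = (\<integral>\<^sup>+z. indicator A (a + z) \<partial>\<kappa>)" for a
      by (subst nn_integral_indicator[symmetric], simp, subst nn_integral_distr) simp_all
    then show ?thesis using law[of A] by simp
  qed
qed (use M in simp_all)

lemma emeasure_law_of_independent_sum:
  fixes u :: "'a \<Rightarrow> 'b::{real_normed_vector, second_countable_topology}"
  assumes "prob_space M" "prob_space \<kappa>" and [measurable_cong]: "sets \<kappa> = sets borel"
    and [measurable]: "u \<in> borel_measurable M" "A \<in> sets borel"
  shows "emeasure (distr (M \<Otimes>\<^sub>M \<kappa>) borel (\<lambda>(x, z). u x + z)) A = (\<integral>\<^sup>+x. \<integral>\<^sup>+z. indicator A (u x + z) \<partial>\<kappa> \<partial>M)"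
proof -
  interpret K: prob_space \<kappa> by fact
  have "emeasure (distr (M \<Otimes>\<^sub>M \<kappa>) borel (\<lambda>(x, z). u x + z)) A
      = (\<integral>\<^sup>+p. indicator A (u (fst p) + snd p) \<partial>(M \<Otimes>\<^sub>M \<kappa>))"
    by (subst nn_integral_indicator[symmetric], simp, subst nn_integral_distr) (simp_all add: case_prod_beta')
  also have "\<dots> = (\<integral>\<^sup>+x. \<integral>\<^sup>+z. indicator A (u x + z) \<partial>\<kappa> \<partial>M)"
    by (subst K.nn_integral_fst[symmetric]) simp_all
  finally show ?thesis .
qed

theorem theorem9:
  fixes \<mu> :: "'a::{banach, second_countable_topology} measure"
    and m :: 'a
    and C :: "('a \<Rightarrow>\<^sub>L real) \<Rightarrow> 'a"
    and G1 :: "'a \<Rightarrow> 'b::{banach, second_countable_topology}"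
    and G2 :: "'a \<Rightarrow> 'c::{banach, second_countable_topology}"
  assumes "gaussian_measure \<mu>"
    and "is_mean_element \<mu> m"
    and "is_covariance_operator \<mu> m C"
    and "bounded_linear G1"
    and "bounded_linear G2"
  shows "\<exists>(Y01 :: 'b set) (Y02 :: 'c set).
    subspace Y01 \<and> subspace Y02 \<and>
    measure (distr \<mu> borel (\<lambda>x. (G1 x, G2 x))) (Y01 \<times> Y02) = 1 \<and>
    (\<exists>(D :: 'b \<times> 'c \<Rightarrow> 'a measure) (D1 :: 'b \<Rightarrow> 'a measure) (D2 :: 'b \<Rightarrow> 'c \<Rightarrow> 'a measure).
       gaussian_disintegration \<mu> (\<lambda>x. (G1 x, G2 x)) D \<and>
       gaussian_disintegration \<mu> G1 D1 \<and>
       (\<forall>y1. gaussian_disintegration (D1 y1) G2 (D2 y1)) \<and>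
       (\<forall>y1\<in>Y01. \<forall>y2\<in>Y02. D (y1, y2) = D2 y1 y2))"
proof -
  have \<mu>: "gaussian_with \<mu> m C"
    using assms(1-3) by (rule gaussian_withI_mean_covariance)
  interpret \<mu>: prob_space \<mu> using \<mu> by (rule gaussian_withD)
  have s\<mu>[measurable_cong]: "sets \<mu> = sets borel" using \<mu> by (rule gaussian_withD)
  interpret G1: bounded_linear G1 by fact
  interpret G2: bounded_linear G2 by fact
  have [measurable]: "G1 \<in> borel_measurable borel" "G2 \<in> borel_measurable borel"
    by (auto intro!: borel_measurable_continuous_onI linear_continuous_on assms)

  obtain T1 \<kappa>1 C1 where T1[measurable]: "T1 \<in> borel_measurable borel"
    and fix1: "AE x in \<mu>. G1 (T1 (G1 x)) = G1 x"
    and \<kappa>1: "gaussian_with \<kappa>1 0 C1" and ker1: "AE z in \<kappa>1. G1 z = 0"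
    and law1: "\<mu> = distr (\<mu> \<Otimes>\<^sub>M \<kappa>1) borel (\<lambda>(x, z). T1 (G1 x) + z)"
    by (rule gaussian_regression[OF \<mu> assms(4)])
  interpret K1: prob_space \<kappa>1 using \<kappa>1 by (rule gaussian_withD)
  have s\<kappa>1[measurable_cong]: "sets \<kappa>1 = sets borel" using \<kappa>1 by (rule gaussian_withD)

  obtain T2 \<kappa>2 C2 where T2[measurable]: "T2 \<in> borel_measurable borel"
    and fix2: "AE z in \<kappa>1. G2 (T2 (G2 z)) = G2 z"
    and \<kappa>2: "gaussian_with \<kappa>2 0 C2" and ker2: "AE w in \<kappa>2. G2 w = 0"
    and law2: "\<kappa>1 = distr (\<kappa>1 \<Otimes>\<^sub>M \<kappa>2) borel (\<lambda>(z, w). T2 (G2 z) + w)"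
    by (rule gaussian_regression[OF \<kappa>1 assms(5)])
  interpret K2: prob_space \<kappa>2 using \<kappa>2 by (rule gaussian_withD)
  have s\<kappa>2[measurable_cong]: "sets \<kappa>2 = sets borel" using \<kappa>2 by (rule gaussian_withD)

  define D1 where "D1 y1 = distr \<kappa>1 borel (\<lambda>z. T1 y1 + z)" for y1
  \<comment> \<open>the measure given G1 = y1 is \<kappa>1 shifted by T1 y1; subtracting the shift of G2
    leads back to the regression T2 under \<kappa>1\<close>
  define S where "S y1 y2 = T1 y1 + T2 (y2 - G2 (T1 y1))" for y1 y2
  define D2 where "D2 y1 y2 = distr \<kappa>2 borel (\<lambda>w. S y1 y2 + w)" for y1 y2

  have dis1: "disintegration \<mu> borel G1 D1"
    unfolding D1_def
  proof (rule disintegration_translates)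
    show "emeasure \<mu> A = (\<integral>\<^sup>+x. \<integral>\<^sup>+z. indicator A (T1 (G1 x) + z) \<partial>\<kappa>1 \<partial>\<mu>)" if A: "A \<in> sets borel" for A
      using emeasure_law_of_independent_sum[of \<mu> \<kappa>1 "\<lambda>x. T1 (G1 x)" A] A law1 s\<kappa>1
      by (simp add: \<mu>.prob_space_axioms K1.prob_space_axioms)
    show "AE x in \<mu>. AE z in \<kappa>1. G1 (T1 (G1 x) + z) = G1 x"
      using fix1
    proof eventually_elim
      case (elim x)
      show ?case using ker1 by eventually_elim (simp add: G1.add elim)
    qed
  qed (simp_all add: \<mu>.prob_space_axioms K1.prob_space_axioms s\<mu> s\<kappa>1)

  have dis2: "disintegration (D1 y1) borel G2 (D2 y1)" for y1
    unfolding D2_def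
  proof (rule disintegration_translates)
    show "prob_space (D1 y1)" unfolding D1_def by (rule K1.prob_space_distr) simp
    have [measurable]: "S y1 \<in> borel_measurable borel" unfolding S_def by measurable
    then show "S y1 \<in> borel_measurable borel" .
    have S: "S y1 (G2 (T1 y1 + z)) = T1 y1 + T2 (G2 z)" for z by (simp add: S_def G2.add)
    show "emeasure (D1 y1) A = (\<integral>\<^sup>+x. \<integral>\<^sup>+w. indicator A (S y1 (G2 x) + w) \<partial>\<kappa>2 \<partial>D1 y1)" if A[measurable]: "A \<in> sets borel" for A
    proof -
      define B where "B = {x. T1 y1 + x \<in> A}"
      have "(\<lambda>x. T1 y1 + x) -` A \<inter> space borel \<in> sets borel" by measurable
      then have B[measurable]: "B \<in> sets borel" by (simp add: B_def vimage_def)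
      have "emeasure (D1 y1) A = emeasure \<kappa>1 B"
        unfolding D1_def B_def by (subst emeasure_distr) (simp_all add: vimage_def sets_eq_imp_space_eq[OF s\<kappa>1])
      also have "\<dots> = (\<integral>\<^sup>+z. \<integral>\<^sup>+w. indicator B (T2 (G2 z) + w) \<partial>\<kappa>2 \<partial>\<kappa>1)"
        using emeasure_law_of_independent_sum[of \<kappa>1 \<kappa>2 "\<lambda>z. T2 (G2 z)" B] law2 s\<kappa>2
        by (simp add: K1.prob_space_axioms K2.prob_space_axioms)
      also have "\<dots> = (\<integral>\<^sup>+z. \<integral>\<^sup>+w. indicator A (S y1 (G2 (T1 y1 + z)) + w) \<partial>\<kappa>2 \<partial>\<kappa>1)"
        unfolding S by (simp add: B_def indicator_def add.assoc)
      also have "\<dots> = (\<integral>\<^sup>+x. \<integral>\<^sup>+w. indicator A (S y1 (G2 x) + w) \<partial>\<kappa>2 \<partial>D1 y1)"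
        unfolding D1_def by (subst nn_integral_distr) simp_all
      finally show ?thesis .
    qed
    have "AE z in \<kappa>1. AE w in \<kappa>2. G2 (S y1 (G2 (T1 y1 + z)) + w) = G2 (T1 y1 + z)"
      using fix2
    proof eventually_elim
      case (elim z)
      show ?case unfolding S using ker2 by eventually_elim (simp add: G2.add elim)
    qed
    moreover have "Measurable.pred borel (\<lambda>x. AE w in \<kappa>2. G2 (S y1 (G2 x) + w) = G2 x)"
    proof (rule pred_AE_kernel)
      have "\<kappa>2 \<in> space (prob_algebra borel)"
        by (simp add: space_prob_algebra K2.prob_space_axioms s\<kappa>2)
      then show "(\<lambda>_. \<kappa>2) \<in> measurable borel (prob_algebra borel)" by (rule measurable_const)
    qed measurable
    ultimately show "AE x in D1 y1. AE w in \<kappa>2. G2 (S y1 (G2 x) + w) = G2 x"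
      unfolding D1_def by (subst AE_distr_iff) (simp_all add: pred_def)
  qed (simp_all add: D1_def K2.prob_space_axioms s\<kappa>2)

  define D where "D = (\<lambda>(y1, y2). D2 y1 y2)"
  have "D \<in> measurable borel (prob_algebra borel)"
    unfolding D_def D2_def case_prod_beta' borel_prod[symmetric]
    by (rule translate_kernel_measurable) (simp_all add: K2.prob_space_axioms s\<kappa>2 S_def)
  moreover have "prob_algebra \<mu> = prob_algebra borel" using subprob_algebra_cong[OF s\<mu>] by (simp add: prob_algebra_def)
  ultimately have dis: "disintegration \<mu> borel (\<lambda>x. (G1 x, G2 x)) D"
    using iterated_disintegration[OF dis1 dis2] by (simp add: D_def)

  have gauss: "gaussian_measure (D1 y1)" "gaussian_measure (D2 y1 y2)" for y1 y2
    unfolding D1_def D2_def by (rule gaussian_measure_translate[OF \<kappa>1] gaussian_measure_translate[OF \<kappa>2])+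
  have "(\<lambda>x. (G1 x, G2 x)) \<in> borel_measurable \<mu>" by measurable
  from prob_space.prob_space[OF \<mu>.prob_space_distr[OF this]]
  have full: "measure (distr \<mu> borel (\<lambda>x. (G1 x, G2 x))) (UNIV \<times> UNIV) = 1" by simp
  show ?thesis
  proof (intro exI conjI ballI allI)
    show "subspace (UNIV :: 'b set)" "subspace (UNIV :: 'c set)" by (rule subspace_UNIV)+
    show "measure (distr \<mu> borel (\<lambda>x. (G1 x, G2 x))) (UNIV \<times> UNIV) = 1" by (rule full)
    show "gaussian_disintegration \<mu> (\<lambda>x. (G1 x, G2 x)) D"
      using dis gauss(2) by (simp add: gaussian_disintegration_def D_def case_prod_beta)
    show "gaussian_disintegration \<mu> G1 D1" "gaussian_disintegration (D1 y1) G2 (D2 y1)" for y1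
      using dis1 dis2 gauss by (simp_all add: gaussian_disintegration_def)
    show "D (y1, y2) = D2 y1 y2" for y1 y2 by (simp add: D_def)
  qed
qed

end
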